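(* Let $N\geq 2$, let $z_1,\dots,z_N$ be real numbers such that $z_i-z_j\neq1$ for all $i,j$, and let $b_1,\dots,b_N$ be complex numbers. Let $\mathcal Q^d$ be the $N\times N$ matrix with entries $$(\mathcal Q^d)_{ij}=\frac{b_j}{z_i-z_j+1},\qquad i,j=1,\dots,N$$ (so that $(\mathcal Q^d)_{ii}=b_i$). Let $Q_1,\dots,Q_N$ be the eigenvalues of $\mathcal Q^d$, and assume that $Q_1,\dots,Q_N$ are nonzero distinct real numbers. Then: (1) If $|z_i-z_j|>1$ for all $i\ne j$, then the numbers $b_1,\dots,b_N$ are real. (2) Let the $Q_i$ be either all positive or all negative. Assume that there exists a subset $I\subset\{1,\dots,N\}$ such that $|z_i-z_j|\ge1$ for $i\neq j$ provided either $i,j\in I$ or $i,j\notin I$. Then the numbers $b_1,\dots,b_N$ are real. *)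

theory Defs
  imports "Jordan_Normal_Form.Spectral_Radius"
begin

(* Rows and columns are indexed by 0, ..., N - 1, the index convention of type mat. *)
definition Qd :: "nat \<Rightarrow> (nat \<Rightarrow> real) \<Rightarrow> (nat \<Rightarrow> complex) \<Rightarrow> complex mat" where
  "Qd N z b = mat N N (\<lambda>(i, j). b j / complex_of_real (z i - z j + 1))"

end

(* The b_j, divided by the real factors mu_j = prod over t != j of (z_t - z_j + 1) / (z_t - z_j), are joint
   eigenvalues of operators that are self-adjoint for a positive form. Consider functions G(tau, w) of two
   permutations, where tau orders the points z_j and w orders N labels, satisfying the R-matrix exchange
   relations for adjacent transpositions (space F). On F act commuting operators Y_a, one for each label a,
   which rotate tau and w cyclically and multiply by b_j / mu_j. On the functions depending only on the
   position of the label a, Y_a is conjugate to Qd, so that prod_j (Y_a - Q_j) kills the constant function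
   1. Since the Y_a commute, applying suitable polynomials in them to 1 yields a joint eigenvector G of all
   Y_a with real eigenvalues l_a. The sum B of G(tau, w) * cnj G(tau w0, w w0) over w, with w0 the order
   reversal, does not depend on tau; rotating tau cyclically multiplies it by the quotient of b_j / mu_j and
   its conjugate. Hence b_j is real once B is nonzero. If tau lists I first, rotating by card I turns w0
   into the reversal of both blocks at the cost of a product of the l_a, and the resulting form is diagonal
   with positive entries, because 1 + 1 / (z_i - z_j) > 0 whenever |z_i - z_j| > 1. Part (1) is the case of
   empty I, where no product of the l_a appears and their signs do not matter. *)

theory Submission
  imports Defs "HOL-Combinatorics.Permutations"
begin

section \<open>Joint eigenvectors of commuting operators\<close>

text \<open>The product of the factors \<open>A - q\<close> applied to \<open>g\<close>, head of the
  list outermost. Operators are plain maps on functions, so that the notion serves both for a matrix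
  and for the operators \<open>Y\<close> below.\<close>

definition shift_prod :: "(('x \<Rightarrow> complex) \<Rightarrow> 'x \<Rightarrow> complex) \<Rightarrow> complex list \<Rightarrow> ('x \<Rightarrow> complex) \<Rightarrow> 'x \<Rightarrow> complex"
  where "shift_prod A qs g = foldr (\<lambda>q h x. A h x - q * h x) qs g"

lemma shift_prod_Nil [simp]: "shift_prod A [] g = g"
  and shift_prod_Cons: "shift_prod A (q # qs) g = (\<lambda>x. A (shift_prod A qs g) x - q * shift_prod A qs g x)"
  by (simp_all add: shift_prod_def)

text \<open>Drop factors from the front until the product no longer kills \<open>v\<close>; what
  remains, applied to \<open>v\<close>, is an eigenvector for the factor dropped last.\<close>

lemma shift_prod_zeroE:
  assumes "shift_prod A qs v = (\<lambda>_. 0)" "v \<noteq> (\<lambda>_. 0)"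
  obtains ys q where "q \<in> set qs" "shift_prod A ys v \<noteq> (\<lambda>_. 0)"
    "A (shift_prod A ys v) = (\<lambda>x. q * shift_prod A ys v x)"
  using assms
proof (induction qs arbitrary: thesis)
  case Nil
  then show ?case by simp
next
  case (Cons q qs)
  show ?case
  proof (cases "shift_prod A qs v = (\<lambda>_. 0)")
    case True
    show ?thesis
    proof (rule Cons.IH)
      fix q' ys
      assume "q' \<in> set qs" "shift_prod A ys v \<noteq> (\<lambda>_. 0)"
        "A (shift_prod A ys v) = (\<lambda>x. q' * shift_prod A ys v x)"
      then show thesis by (intro Cons.prems(1)[of q' ys]) auto
    qed (use True Cons.prems in auto)
  next
    case False
    show ?thesis
    proof (rule Cons.prems(1))
      show "A (shift_prod A qs v) = (\<lambda>x. q * shift_prod A qs v x)"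
        using Cons.prems(2) by (simp add: shift_prod_Cons fun_eq_iff)
    qed (use False in auto)
  qed
qed

text \<open>Induction on the set of operators treated so far. Each new vector is a partial product
  of shifts of the next operator applied to the old one; by commutation this spoils neither the
  earlier eigenvalue equations nor the annihilation by the full products.\<close>

lemma joint_eigenvector:
  fixes V :: "('x \<Rightarrow> complex) set" and Y :: "'i \<Rightarrow> ('x \<Rightarrow> complex) \<Rightarrow> 'x \<Rightarrow> complex"
  assumes V: "\<And>G H c. G \<in> V \<Longrightarrow> H \<in> V \<Longrightarrow> (\<lambda>x. G x - c * H x) \<in> V"
    and Y: "\<And>i G. i \<in> A \<Longrightarrow> G \<in> V \<Longrightarrow> Y i G \<in> V"
    and lin: "\<And>i G H c. i \<in> A \<Longrightarrow> G \<in> V \<Longrightarrow> H \<in> V \<Longrightarrow>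
      Y i (\<lambda>x. G x - c * H x) = (\<lambda>x. Y i G x - c * Y i H x)"
    and comm: "\<And>i j G. i \<in> A \<Longrightarrow> j \<in> A \<Longrightarrow> G \<in> V \<Longrightarrow> Y i (Y j G) = Y j (Y i G)"
    and "finite A" and v0: "v0 \<in> V" "v0 \<noteq> (\<lambda>_. 0)"
    and kill: "\<And>i. i \<in> A \<Longrightarrow> shift_prod (Y i) qs v0 = (\<lambda>_. 0)"
  shows "\<exists>v\<in>V. v \<noteq> (\<lambda>_. 0) \<and> (\<exists>l. \<forall>i\<in>A. l i \<in> set qs \<and> Y i v = (\<lambda>x. l i * v x))"
proof -
  have zero: "(\<lambda>_. 0) \<in> V" using V[OF v0(1) v0(1), of 1] by simp
  have Y0: "Y i (\<lambda>_. 0) = (\<lambda>_. 0)" if "i \<in> A" for i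
    using lin[OF that v0(1) v0(1), of 1] by simp
  have hom: "Y i (\<lambda>x. c * G x) = (\<lambda>x. c * Y i G x)" if "i \<in> A" "G \<in> V" for i c G
    using lin[OF that(1) zero that(2), of "- c"] Y0[OF that(1)] by simp
  have Vsp: "shift_prod (Y i) ys G \<in> V" if "i \<in> A" "G \<in> V" for i ys G
    by (induction ys) (use that V Y in \<open>auto simp: shift_prod_Cons\<close>)
  have sp_step: "shift_prod (Y c) ys (\<lambda>x. Y i h x - q * h x) =
      (\<lambda>x. Y i (shift_prod (Y c) ys h) x - q * shift_prod (Y c) ys h x)"
    if "c \<in> A" "i \<in> A" "h \<in> V" for c i h q ys
  proof (induction ys)
    case Nil
    then show ?case by simp
  next
    case (Cons y ys)
    let ?s = "shift_prod (Y c) ys h"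
    have s: "?s \<in> V" "Y i ?s \<in> V" "Y c ?s \<in> V" using Vsp Y that by auto
    show ?case
      unfolding shift_prod_Cons Cons.IH
      using lin[OF that(1) s(2) s(1), of q] lin[OF that(2) s(3) s(1), of y] comm[OF that(1,2) s(1)]
      by (simp add: fun_eq_iff algebra_simps)
  qed
  have "\<exists>v\<in>V. v \<noteq> (\<lambda>_. 0) \<and> (\<forall>i\<in>A. shift_prod (Y i) qs v = (\<lambda>_. 0)) \<and>
      (\<exists>l. \<forall>i\<in>B. l i \<in> set qs \<and> Y i v = (\<lambda>x. l i * v x))" if "finite B" "B \<subseteq> A" for B
    using that
  proof (induction B rule: finite_induct)
    case empty
    then show ?case using v0 kill by auto
  next
    case (insert i B)
    then obtain v l where v: "v \<in> V" "v \<noteq> (\<lambda>_. 0)"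
        "\<forall>i\<in>A. shift_prod (Y i) qs v = (\<lambda>_. 0)"
        and l: "\<forall>i\<in>B. l i \<in> set qs \<and> Y i v = (\<lambda>x. l i * v x)" by auto
    have i: "i \<in> A" and B: "B \<subseteq> A" using insert.prems by auto
    obtain ys q where q: "q \<in> set qs" and
      h: "shift_prod (Y i) ys v \<noteq> (\<lambda>_. 0)"
         "Y i (shift_prod (Y i) ys v) = (\<lambda>x. q * shift_prod (Y i) ys v x)"
      using shift_prod_zeroE v i by metis
    \<comment> \<open>\<open>U\<close> collects the invariants of the induction apart from
      nonvanishing. It is stable under \<open>Y i - p\<close>, hence contains all partial products
      applied to \<open>v\<close>.\<close>
    define U where "U = {h\<in>V. (\<forall>c\<in>A. shift_prod (Y c) qs h = (\<lambda>_. 0)) \<and> (\<forall>c\<in>B. Y c h = (\<lambda>x. l c * h x))}"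
    have U: "(\<lambda>x. Y i h x - p * h x) \<in> U" if h: "h \<in> U" for h p
    proof -
      have hV: "h \<in> V" "Y i h \<in> V" using h Y i by (auto simp: U_def)
      have "Y c (\<lambda>x. Y i h x - p * h x) = (\<lambda>x. l c * (Y i h x - p * h x))" if c: "c \<in> B" for c
      proof -
        have cA: "c \<in> A" and hc: "Y c h = (\<lambda>x. l c * h x)" using c B h by (auto simp: U_def)
        show ?thesis
          using lin[OF cA hV(2,1), of p] comm[OF cA i hV(1)] hom[OF i hV(1), of "l c"] hc
          by (simp add: algebra_simps)
      qed
      then show ?thesis
        using h hV V i by (auto simp: U_def sp_step Y0)
    qed
    have "shift_prod (Y i) ys v \<in> U" for ys
    proof (induction ys)
      case Nil
      then show ?case using v l by (simp add: U_def)
    next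
      case (Cons y ys)
      then show ?case using U by (simp add: shift_prod_Cons)
    qed
    then have hU: "shift_prod (Y i) ys v \<in> U" .
    have "\<forall>c\<in>insert i B. (l(i := q)) c \<in> set qs \<and>
       Y c (shift_prod (Y i) ys v) = (\<lambda>x. (l(i := q)) c * shift_prod (Y i) ys v x)"
      using hU h(2) q l insert.hyps(2) by (auto simp: U_def)
    then show ?case using hU h(1) unfolding U_def by blast
  qed
  from this[OF \<open>finite A\<close>] show ?thesis by blast
qed

section \<open>Annihilation by a polynomial with the eigenvalues as roots\<close>

lemma shift_prod_eigen_sum:
  fixes A :: "(nat \<Rightarrow> complex) \<Rightarrow> nat \<Rightarrow> complex"
  assumes A: "\<And>g k. A g k = (\<Sum>j<N. a k j * g j)"
    and ev: "\<And>i k. i < N \<Longrightarrow> k < N \<Longrightarrow> (\<Sum>j<N. a k j * v i j) = Q i * v i k"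
    and g: "\<And>k. k < N \<Longrightarrow> g k = (\<Sum>i<N. c i * v i k)"
  shows "k < N \<Longrightarrow> shift_prod A qs g k = (\<Sum>i<N. (\<Prod>q\<leftarrow>qs. Q i - q) * c i * v i k)"
proof (induction qs arbitrary: k)
  case Nil
  then show ?case using g by simp
next
  case (Cons q qs)
  let ?p = "\<lambda>i. (\<Prod>q\<leftarrow>qs. Q i - q)"
  have "A (shift_prod A qs g) k = (\<Sum>j<N. a k j * (\<Sum>i<N. ?p i * c i * v i j))"
    unfolding A[of "shift_prod A qs g" k] by (intro sum.cong refl) (simp add: Cons.IH)
  also have "\<dots> = (\<Sum>i<N. ?p i * c i * (\<Sum>j<N. a k j * v i j))"
    unfolding sum_distrib_left by (subst sum.swap) (simp add: mult_ac)
  also have "\<dots> = (\<Sum>i<N. ?p i * c i * (Q i * v i k))"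
    using Cons.prems ev by (intro sum.cong) auto
  finally show ?case
    using Cons by (simp add: shift_prod_Cons sum_distrib_left sum_subtractf[symmetric] algebra_simps)
qed

text \<open>Distinct eigenvalues give a basis of eigenvectors, and each of these is killed by its
  own factor.\<close>

lemma shift_prod_spectrum:
  assumes M: "M \<in> carrier_mat N N" and sp: "spectrum M = Q ` {..<N}" and inj: "inj_on Q {..<N}"
    and k: "k < N"
  shows "shift_prod (\<lambda>g k. \<Sum>j<N. M $$ (k, j) * g j) (map Q [0..<N]) g k = 0"
proof -
  let ?A = "\<lambda>g k. \<Sum>j<N. M $$ (k, j) * g j"
  have "\<exists>v. eigenvector M v (Q i)" if "i < N" for i
    using sp that unfolding spectrum_def eigenvalue_def by blast
  then obtain u where u: "\<And>i. i < N \<Longrightarrow> eigenvector M (u i) (Q i)" by metis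
  have uc: "u i \<in> carrier_vec N" and u0: "u i \<noteq> 0\<^sub>v N" and ue: "M *\<^sub>v u i = Q i \<cdot>\<^sub>v u i" if "i < N" for i
    using u[OF that] M unfolding eigenvector_def by auto
  define v where "v i k = u i $ k" for i k
  have ev: "(\<Sum>j<N. M $$ (k, j) * v i j) = Q i * v i k" if "i < N" "k < N" for i k
  proof -
    have "(M *\<^sub>v u i) $ k = (\<Sum>j<N. M $$ (k, j) * v i j)"
      using M that uc[OF that(1)] by (simp add: scalar_prod_def v_def atLeast0LessThan)
    then show ?thesis using ue[OF that(1)] that uc[OF that(1)] by (simp add: v_def)
  qed
  note main = shift_prod_eigen_sum[of ?A "\<lambda>k j. M $$ (k, j)" N v Q, OF refl ev]
  define W where "W = mat N N (\<lambda>(k, i). v i k)"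
  have W: "W \<in> carrier_mat N N" by (simp add: W_def)
  have Wx: "(W *\<^sub>v x) $ k = (\<Sum>i<N. x $ i * v i k)" if "x \<in> carrier_vec N" "k < N" for x k
    using that by (simp add: W_def scalar_prod_def atLeast0LessThan mult_ac)
  have "det W \<noteq> 0"
  proof
    assume "det W = 0"
    then obtain x where x: "x \<in> carrier_vec N" "x \<noteq> 0\<^sub>v N" "W *\<^sub>v x = 0\<^sub>v N"
      using det_0_iff_vec_prod_zero_field[OF W] by auto
    then obtain i where i: "i < N" "x $ i \<noteq> 0"
      by (metis carrier_vecD eq_vecI index_zero_vec(1) index_zero_vec(2))
    \<comment> \<open>All factors but the \<open>i\<close>-th: applied to a linear dependence of the
      eigenvectors they leave only the \<open>i\<close>-th term.\<close>
    define qs where "qs = map Q (filter (\<lambda>j. j \<noteq> i) [0..<N])"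
    have z: "(\<Sum>i<N. x $ i * v i k) = 0" if "k < N" for k
      using Wx[OF x(1) that] x(3) that by simp
    have pz: "(\<Prod>q\<leftarrow>qs. Q l - q) = 0" if "l < N" "l \<noteq> i" for l
      using that by (auto simp: qs_def prod_list_zero_iff image_iff)
    have pi: "(\<Prod>q\<leftarrow>qs. Q i - q) \<noteq> 0"
      using i inj by (auto simp: qs_def prod_list_zero_iff dest: inj_onD)
    have 0: "(\<Prod>q\<leftarrow>qs. Q i - q) * x $ i * v i k = 0" if "k < N" for k
    proof -
      \<comment> \<open>The zero function is expanded in the eigenvectors twice, with the
        coefficients of the dependence and with coefficients 0.\<close>
      have "shift_prod ?A qs (\<lambda>_. 0) k = (\<Sum>i<N. (\<Prod>q\<leftarrow>qs. Q i - q) * x $ i * v i k)"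
        by (rule main) (use z that in auto)
      moreover have "shift_prod ?A qs (\<lambda>_. 0) k = (\<Sum>i<N. (\<Prod>q\<leftarrow>qs. Q i - q) * 0 * v i k)"
        by (rule main[where c = "\<lambda>_. 0"]) (use that in auto)
      moreover have "(\<Sum>i<N. (\<Prod>q\<leftarrow>qs. Q i - q) * x $ i * v i k) =
          (\<Sum>l<N. if l = i then (\<Prod>q\<leftarrow>qs. Q i - q) * x $ i * v i k else 0)"
        by (intro sum.cong) (use pz in auto)
      ultimately show ?thesis using i by simp
    qed
    have "u i = 0\<^sub>v N"
    proof (rule eq_vecI)
      fix k assume "k < dim_vec (0\<^sub>v N)"
      then show "u i $ k = 0\<^sub>v N $ k" using 0[of k] pi i by (simp add: v_def)
    qed (use uc i in auto)
    then show False using u0 i by simp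
  qed
  then obtain W' where W': "W' \<in> carrier_mat N N" "W * W' = 1\<^sub>m N"
    using det_non_zero_imp_unit[OF W, of "TYPE(unit)"] unfolding Units_def ring_mat_def by auto
  define c where "c = W' *\<^sub>v vec N g"
  have c: "c \<in> carrier_vec N" using W' by (simp add: c_def)
  have "W *\<^sub>v c = vec N g"
    using W W' by (simp add: c_def assoc_mult_mat_vec[symmetric, of _ N N _ N])
  then have gk: "g k = (\<Sum>i<N. c $ i * v i k)" if "k < N" for k
    using Wx[OF c that] that by simp
  have "shift_prod ?A (map Q [0..<N]) g k = (\<Sum>i<N. (\<Prod>q\<leftarrow>map Q [0..<N]. Q i - q) * c $ i * v i k)"
    by (rule main) (use gk k in auto)
  also have "\<dots> = 0"
    by (intro sum.neutral ballI) (auto simp: prod_list_zero_iff image_iff)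
  finally show ?thesis .
qed

section \<open>Block permutations and inversions\<close>

abbreviation adj :: "nat \<Rightarrow> nat \<Rightarrow> nat"
  where "adj i \<equiv> transpose i (Suc i)"

text \<open>The Young subgroup preserving the first \<open>m\<close> places, and hence the remaining
  ones. For \<open>m = 0\<close> it is the full symmetric group.\<close>

definition block_perms :: "nat \<Rightarrow> nat \<Rightarrow> (nat \<Rightarrow> nat) set"
  where "block_perms N m = {v. v permutes {..<N} \<and> (\<forall>i<m. v i < m)}"

text \<open>The longest element of this subgroup; for \<open>m = 0\<close> the full
  reversal.\<close>

definition block_rev :: "nat \<Rightarrow> nat \<Rightarrow> nat \<Rightarrow> nat"
  where "block_rev N m i = (if i < m then m - 1 - i else if i < N then N + m - 1 - i else i)"

definition inv_pairs :: "nat \<Rightarrow> (nat \<Rightarrow> nat) \<Rightarrow> (nat \<times> nat) set"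
  where "inv_pairs N v = {(i, j). i < j \<and> j < N \<and> v j < v i}"

definition inv_count :: "nat \<Rightarrow> (nat \<Rightarrow> nat) \<Rightarrow> nat"
  where "inv_count N v = card (inv_pairs N v)"

lemma adj_permutes: "Suc i < N \<Longrightarrow> adj i permutes {..<N}"
  by (simp add: permutes_swap_id)

lemma comp_adj_adj [simp]: "v \<circ> adj i \<circ> adj i = v"
  by (simp add: fun_eq_iff)

lemma block_perms_permutes: "v \<in> block_perms N m \<Longrightarrow> v permutes {..<N}"
  by (simp add: block_perms_def)

lemma block_perms_0: "block_perms N 0 = {v. v permutes {..<N}}"
  by (simp add: block_perms_def)

lemma id_block_perms [simp]: "id \<in> block_perms N m"
  by (simp add: block_perms_def permutes_id)

lemma block_perms_comp: "v \<in> block_perms N m \<Longrightarrow> w \<in> block_perms N m \<Longrightarrow> v \<circ> w \<in> block_perms N m"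
  by (simp add: block_perms_def permutes_compose)

lemma adj_block_perms: "Suc i < N \<Longrightarrow> Suc i \<noteq> m \<Longrightarrow> adj i \<in> block_perms N m"
  by (auto simp: block_perms_def adj_permutes transpose_def)

lemma finite_block_perms [simp]: "finite (block_perms N m)"
  by (rule finite_subset[OF _ finite_permutations[of "{..<N}"]]) (auto simp: block_perms_def)

lemma block_perms_lt_iff:
  assumes v: "v \<in> block_perms N m" and m: "m \<le> N"
  shows "v i < m \<longleftrightarrow> i < m"
proof
  assume "v i < m"
  have inj: "inj_on v {..<m}"
    using v by (auto simp: block_perms_def intro: inj_on_subset[OF permutes_inj])
  have "v ` {..<m} = {..<m}"
    by (rule endo_inj_surj) (use v inj in \<open>auto simp: block_perms_def\<close>)
  then obtain j where "j < m" "v i = v j" using \<open>v i < m\<close> by (metis imageE lessThan_iff)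
  then show "i < m"
    using v permutes_inj by (metis block_perms_permutes injD)
qed (use v in \<open>auto simp: block_perms_def\<close>)

lemma block_rev_involution [simp]: "m \<le> N \<Longrightarrow> block_rev N m (block_rev N m i) = i"
  by (auto simp: block_rev_def)

lemma block_rev_comp [simp]:
  "m \<le> N \<Longrightarrow> v \<circ> block_rev N m \<circ> block_rev N m = v"
  "m \<le> N \<Longrightarrow> block_rev N m \<circ> block_rev N m = id"
  by (simp_all add: fun_eq_iff)

lemma block_rev_block_perms: "m \<le> N \<Longrightarrow> block_rev N m \<in> block_perms N m"
  unfolding block_perms_def
proof (intro CollectI conjI)
  assume m: "m \<le> N"
  show "block_rev N m permutes {..<N}"
  proof (rule bij_imp_permutes)
    show "bij_betw (block_rev N m) {..<N} {..<N}"
      by (rule bij_betw_byWitness[where f' = "block_rev N m"]) (use m in \<open>auto simp: block_rev_def\<close>)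
  qed (use m in \<open>auto simp: block_rev_def\<close>)
qed (auto simp: block_rev_def)

text \<open>Conjugation by the longest element permutes the adjacent transpositions of the subgroup.
  Reversal turns a pair of neighbours around, so the smaller index \<open>i'\<close> is the image of
  \<open>Suc i\<close>.\<close>

lemma block_rev_adj:
  assumes m: "m \<le> N" and i: "Suc i < N" "Suc i \<noteq> m"
  defines "i' \<equiv> block_rev N m (Suc i)"
  shows "Suc i' < N" "Suc i' \<noteq> m" "Suc i' = block_rev N m i"
    "adj i \<circ> block_rev N m = block_rev N m \<circ> adj i'"
proof -
  show Suc: "Suc i' = block_rev N m i" "Suc i' < N" "Suc i' \<noteq> m"
    using m i by (auto simp: i'_def block_rev_def)
  have i: "i = block_rev N m (Suc i')" "Suc i = block_rev N m i'"
    using m unfolding Suc(1) by (simp_all add: i'_def)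
  have inj: "inj (block_rev N m)" by (metis block_rev_involution injI m)
  show "adj i \<circ> block_rev N m = block_rev N m \<circ> adj i'"
    unfolding i(2) unfolding i(1)
    by (auto simp: fun_eq_iff transpose_def inj_eq[OF inj])
qed

lemma finite_inv_pairs [simp]: "finite (inv_pairs N v)"
  by (rule finite_subset[of _ "{..<N} \<times> {..<N}"]) (auto simp: inv_pairs_def)

text \<open>Renaming places by \<open>adj i\<close> carries the old inversions injectively to new
  ones; the ascent at \<open>i\<close> adds just the pair \<open>(i, Suc i)\<close>.\<close>

lemma inv_count_comp_adj:
  assumes i: "Suc i < N" and lt: "v i < v (Suc i)"
  shows "inv_count N (v \<circ> adj i) = Suc (inv_count N v)"
proof -
  let ?f = "\<lambda>(a, b). (adj i a, adj i b)"
  have eq: "inv_pairs N (v \<circ> adj i) = insert (i, Suc i) (?f ` inv_pairs N v)"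
  proof (rule Set.set_eqI, rule iffI)
    fix p assume p: "p \<in> inv_pairs N (v \<circ> adj i)"
    obtain a b where ab: "p = (a, b)" by force
    show "p \<in> insert (i, Suc i) (?f ` inv_pairs N v)"
    proof (cases "a = i \<and> b = Suc i")
      case False
      then have "?f p \<in> inv_pairs N v"
        using p i lt ab by (auto simp: inv_pairs_def transpose_def split: if_splits)
      then have "?f (?f p) \<in> ?f ` inv_pairs N v" by (rule imageI)
      then show ?thesis using ab by simp
    qed (use ab in simp)
  next
    fix p assume "p \<in> insert (i, Suc i) (?f ` inv_pairs N v)"
    then show "p \<in> inv_pairs N (v \<circ> adj i)"
      using i lt by (auto simp: inv_pairs_def transpose_def split: if_splits)
  qed
  have "inj_on ?f (inv_pairs N v)"
    by (rule inj_onI) (auto dest: injD[OF inj_transpose])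
  moreover have "(i, Suc i) \<notin> ?f ` inv_pairs N v"
    using i lt by (auto simp: inv_pairs_def transpose_def split: if_splits)
  ultimately show ?thesis
    unfolding inv_count_def eq by (simp add: card_image)
qed

text \<open>A block permutation inverts only pairs inside one block, and \<open>block_rev\<close>
  inverts all of those.\<close>

lemma inv_count_le_block_rev:
  assumes v: "v \<in> block_perms N m" and m: "m \<le> N"
  shows "inv_count N v \<le> inv_count N (block_rev N m)"
  unfolding inv_count_def
proof (rule card_mono)
  show "inv_pairs N v \<subseteq> inv_pairs N (block_rev N m)"
  proof (safe)
    fix i j assume "(i, j) \<in> inv_pairs N v"
    then have ij: "i < j" "j < N" "v j < v i" by (auto simp: inv_pairs_def)
    have "i < m \<longleftrightarrow> j < m"
      using ij block_perms_lt_iff[OF v m, of i] block_perms_lt_iff[OF v m, of j] by linarith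
    then show "(i, j) \<in> inv_pairs N (block_rev N m)"
      using ij by (auto simp: inv_pairs_def block_rev_def)
  qed
qed simp

text \<open>Strict growth gives \<open>i \<le> v i\<close> counting up from 0 and
  \<open>v i \<le> i\<close> counting down from \<open>N - 1\<close>.\<close>

lemma permutes_no_descent:
  assumes v: "v permutes {..<N}" and le: "\<And>i. Suc i < N \<Longrightarrow> v i < v (Suc i)"
  shows "v = id"
proof -
  have "i \<le> v i" if "i < N" for i
    using that
  proof (induction i)
    case (Suc i)
    then show ?case using le[of i] by simp
  qed simp
  moreover have "v i \<le> i" if "i < N" for i
  proof -
    have "v i + d \<le> v (i + d)" if "i + d < N" for d
      using that
    proof (induction d)
      case (Suc d)
      then show ?case using le[of "i + d"] by simp
    qed simp
    from this[of "N - 1 - i"] have "v i + (N - 1 - i) \<le> v (N - 1)" using that by simp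
    moreover have "v (N - 1) < N" using permutes_in_image[OF v, of "N - 1"] that by simp
    ultimately show ?thesis using that by linarith
  qed
  ultimately show ?thesis
    using permutes_not_in[OF v] by (metis eq_id_iff le_antisym lessThan_iff)
qed

text \<open>Induction along reduced words: a block permutation other than \<open>id\<close> has a
  descent, never across the border of the blocks, and undoing it lowers the inversion
  number.\<close>

lemma block_perms_induct [consumes 2, case_names id adj]:
  assumes v: "v \<in> block_perms N m" and m: "m \<le> N" and P_id: "P id"
    and step: "\<And>v i. v \<in> block_perms N m \<Longrightarrow> Suc i < N \<Longrightarrow> Suc i \<noteq> m \<Longrightarrow> v i < v (Suc i) \<Longrightarrow> P v \<Longrightarrow> P (v \<circ> adj i)"
  shows "P v"
  using v
proof (induction "inv_count N v" arbitrary: v rule: less_induct)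
  case less
  show ?case
  proof (cases "v = id")
    case False
    then obtain i where i: "Suc i < N" "\<not> v i < v (Suc i)"
      using permutes_no_descent block_perms_permutes[OF less.prems] by blast
    have "v i \<noteq> v (Suc i)"
      using permutes_inj[OF block_perms_permutes[OF less.prems]] by (metis injD n_not_Suc_n)
    with i have lt: "v (Suc i) < v i" by simp
    have im: "Suc i \<noteq> m"
      using lt block_perms_lt_iff[OF less.prems m, of i] block_perms_lt_iff[OF less.prems m, of "Suc i"] by linarith
    let ?w = "v \<circ> adj i"
    have w: "?w \<in> block_perms N m"
      using less.prems i im by (simp add: block_perms_comp adj_block_perms)
    have asc: "?w i < ?w (Suc i)" using lt by simp
    have "inv_count N ?w < inv_count N v"
      using inv_count_comp_adj[OF i(1) asc] by (simp only: comp_adj_adj)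
    then have "P ?w" using less.hyps w by blast
    from step[OF w i(1) im asc this] show ?thesis by simp
  qed (use P_id in simp)
qed

section \<open>Cyclic rotations\<close>

definition cyc :: "nat \<Rightarrow> nat \<Rightarrow> nat \<Rightarrow> nat"
  where "cyc N m i = (if i < N then (i + m) mod N else i)"

lemma cyc_0: "cyc N 0 = id"
  by (auto simp: cyc_def)

lemma cyc_Suc: "cyc N (Suc m) = cyc N m \<circ> cyc N 1"
  by (auto simp: cyc_def fun_eq_iff mod_simps)

lemma cyc_1: "cyc N 1 i = (if Suc i < N then Suc i else if Suc i = N then 0 else i)"
  by (auto simp: cyc_def)

lemma cyc_permutes: "cyc N m permutes {..<N}"
proof (induction m)
  case 0
  then show ?case by (simp only: cyc_0 permutes_id)
next
  case (Suc m)
  have inj: "inj_on (cyc N 1) {..<N}"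
    by (rule inj_onI) (auto simp: cyc_1 simp del: One_nat_def split: if_splits)
  have "cyc N 1 ` {..<N} = {..<N}"
    by (rule endo_inj_surj[OF _ _ inj]) (auto simp: cyc_1 simp del: One_nat_def)
  with inj have "bij_betw (cyc N 1) {..<N} {..<N}"
    by (simp only: bij_betw_def)
  then have "cyc N 1 permutes {..<N}"
    by (rule bij_imp_permutes) (simp add: cyc_def)
  from permutes_compose[OF this Suc] show ?case by (simp only: cyc_Suc)
qed

text \<open>This lets a rotation by \<open>m\<close> trade the reversal of the two blocks for the
  full reversal.\<close>

lemma block_rev_cyc: "m \<le> N \<Longrightarrow> block_rev N m \<circ> cyc N m = block_rev N 0"
proof (rule ext)
  fix i assume m: "m \<le> N"
  show "(block_rev N m \<circ> cyc N m) i = block_rev N 0 i"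
  proof (cases "i + m < N")
    case True
    then show ?thesis by (auto simp: block_rev_def cyc_def)
  next
    case False
    then have "i < N \<Longrightarrow> (i + m) mod N = i + m - N" using m by (simp add: le_mod_geq)
    then show ?thesis using m False by (auto simp: block_rev_def cyc_def)
  qed
qed

text \<open>Reversal conjugates the rotation to its inverse; this later moves a rotation from one
  factor of the pairing to the other.\<close>

lemma cyc_block_rev_cyc: "cyc N 1 \<circ> block_rev N 0 \<circ> cyc N 1 = block_rev N 0"
proof (rule ext)
  fix i
  show "(cyc N 1 \<circ> block_rev N 0 \<circ> cyc N 1) i = block_rev N 0 i"
    by (cases "Suc i < N"; cases "Suc i = N") (auto simp: block_rev_def cyc_1 simp del: One_nat_def)
qed

lemma adj_cyc:
  assumes "Suc (Suc i) < N"
  shows "adj (Suc i) \<circ> cyc N 1 = cyc N 1 \<circ> adj i"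
  using assms by (auto simp: cyc_1 transpose_def fun_eq_iff simp del: One_nat_def)

section \<open>Solutions of the exchange relations\<close>

text \<open>HOL-Algebra claims the notation \<open>inv\<close> for inverses in a group.\<close>

abbreviation pinv :: "(nat \<Rightarrow> nat) \<Rightarrow> nat \<Rightarrow> nat"
  where "pinv \<equiv> inv_into UNIV"

text \<open>The theorem does not assume the points distinct; there \<open>z_inj\<close> is derived
  from the eigenvalues being nonzero.\<close>

locale exchange =
  fixes N :: nat and z :: "nat \<Rightarrow> real"
  assumes z_inj: "i < N \<Longrightarrow> j < N \<Longrightarrow> i \<noteq> j \<Longrightarrow> z i \<noteq> z j"
    and z_gap: "i < N \<Longrightarrow> j < N \<Longrightarrow> z i - z j \<noteq> 1"
begin

definition S :: "(nat \<Rightarrow> nat) set" where "S = {p. p permutes {..<N}}"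

lemma S_iff: "p \<in> S \<longleftrightarrow> p permutes {..<N}"
  by (simp add: S_def)

lemma block_perms_S: "v \<in> block_perms N m \<Longrightarrow> v \<in> S"
  by (simp add: S_iff block_perms_permutes)

lemma block_perms_0_eq: "block_perms N 0 = S"
  by (simp add: S_def block_perms_0)

lemma id_S [simp]: "id \<in> S"
  by (simp only: S_iff permutes_id)

definition gap :: "(nat \<Rightarrow> nat) \<Rightarrow> nat \<Rightarrow> complex"
  where "gap \<tau> i = complex_of_real (z (\<tau> i) - z (\<tau> (Suc i)))"

text \<open>Equivalently \<open>G (\<tau> \<circ> s, w \<circ> s) = ((u + P) / (u + 1)) G (\<tau>, w)\<close>, where \<open>s\<close> is the transposition of
  \<open>i\<close> and \<open>i + 1\<close>, \<open>u\<close> is the gap and \<open>P\<close> acts by \<open>w \<mapsto> w \<circ> s\<close>.\<close>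

definition exch :: "nat \<Rightarrow> ((nat \<Rightarrow> nat) \<times> (nat \<Rightarrow> nat) \<Rightarrow> complex) \<Rightarrow> bool"
  where "exch i G \<longleftrightarrow> (\<forall>\<tau>\<in>S. \<forall>w\<in>S.
    (gap \<tau> i + 1) * G (\<tau> \<circ> adj i, w) = gap \<tau> i * G (\<tau>, w \<circ> adj i) + G (\<tau>, w))"

definition F :: "((nat \<Rightarrow> nat) \<times> (nat \<Rightarrow> nat) \<Rightarrow> complex) set"
  where "F = {G. \<forall>i. Suc i < N \<longrightarrow> exch i G}"

lemma exchD:
  "exch i G \<Longrightarrow> \<tau> \<in> S \<Longrightarrow> w \<in> S \<Longrightarrow>
    (gap \<tau> i + 1) * G (\<tau> \<circ> adj i, w) = gap \<tau> i * G (\<tau>, w \<circ> adj i) + G (\<tau>, w)"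
  unfolding exch_def by blast

lemma F_exch: "G \<in> F \<Longrightarrow> Suc i < N \<Longrightarrow> exch i G"
  by (simp add: F_def)

lemma S_comp [simp, intro]: "\<tau> \<in> S \<Longrightarrow> v \<in> S \<Longrightarrow> \<tau> \<circ> v \<in> S"
  by (simp add: S_iff permutes_compose)

lemma S_adj [simp, intro]: "\<tau> \<in> S \<Longrightarrow> Suc i < N \<Longrightarrow> \<tau> \<circ> adj i \<in> S"
  by (simp add: S_iff permutes_compose adj_permutes)

lemma finite_S [simp]: "finite S"
  unfolding S_def by (rule finite_permutations) simp

lemma S_less: "\<tau> \<in> S \<Longrightarrow> i < N \<Longrightarrow> \<tau> i < N"
  using permutes_in_image[of \<tau> "{..<N}" i] by (simp add: S_iff)

lemma S_inj: "\<tau> \<in> S \<Longrightarrow> \<tau> i = \<tau> j \<longleftrightarrow> i = j"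
  using permutes_inj[of \<tau> "{..<N}"] by (auto simp: S_iff dest: injD)

lemma gap_nz:
  assumes "\<tau> \<in> S" "Suc i < N"
  shows "gap \<tau> i \<noteq> 0" "gap \<tau> i + 1 \<noteq> 0" "1 - gap \<tau> i \<noteq> 0"
proof -
  have lt: "\<tau> i < N" "\<tau> (Suc i) < N" "\<tau> i \<noteq> \<tau> (Suc i)"
    using assms S_less S_inj[OF assms(1)] by auto
  let ?r = "z (\<tau> i) - z (\<tau> (Suc i))"
  have r: "?r \<noteq> 0" "?r + 1 \<noteq> 0" "1 - ?r \<noteq> 0"
    using z_inj[OF lt] z_gap[OF lt(1,2)] z_gap[OF lt(2,1)] by linarith+
  have "gap \<tau> i = of_real ?r" "gap \<tau> i + 1 = of_real (?r + 1)" "1 - gap \<tau> i = of_real (1 - ?r)"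
    unfolding gap_def by simp_all
  then show "gap \<tau> i \<noteq> 0" "gap \<tau> i + 1 \<noteq> 0" "1 - gap \<tau> i \<noteq> 0"
    using r by (metis of_real_eq_0_iff)+
qed

lemma gap_adj: "gap (\<tau> \<circ> adj i) i = - gap \<tau> i"
  by (simp add: gap_def)

lemma exch_diff:
  assumes "exch i G" "exch i H"
  shows "exch i (\<lambda>x. G x - c * H x)"
  unfolding exch_def
proof (intro ballI)
  fix \<tau> w assume t: "\<tau> \<in> S" "w \<in> S"
  show "(gap \<tau> i + 1) * (G (\<tau> \<circ> adj i, w) - c * H (\<tau> \<circ> adj i, w)) =
      gap \<tau> i * (G (\<tau>, w \<circ> adj i) - c * H (\<tau>, w \<circ> adj i)) + (G (\<tau>, w) - c * H (\<tau>, w))"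
    using arg_cong2[OF exchD[OF assms(1) t] exchD[OF assms(2) t], of "\<lambda>x y. x - c * y"]
    by (simp add: algebra_simps)
qed

lemma F_diff: "G \<in> F \<Longrightarrow> H \<in> F \<Longrightarrow> (\<lambda>x. G x - c * H x) \<in> F"
  by (simp add: F_def exch_diff)

lemma F_sum:
  assumes "\<And>k. k \<in> K \<Longrightarrow> G k \<in> F"
  shows "(\<lambda>x. \<Sum>k\<in>K. c k * G k x) \<in> F"
  unfolding F_def exch_def
proof (intro CollectI allI impI ballI)
  fix i \<tau> w assume i: "Suc i < N" and t: "\<tau> \<in> S" "w \<in> S"
  have eq: "(gap \<tau> i + 1) * G k (\<tau> \<circ> adj i, w) = gap \<tau> i * G k (\<tau>, w \<circ> adj i) + G k (\<tau>, w)" if "k \<in> K" for k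
    using exchD[OF F_exch[OF assms[OF that] i] t] .
  then have "(gap \<tau> i + 1) * (c k * G k (\<tau> \<circ> adj i, w)) =
      gap \<tau> i * (c k * G k (\<tau>, w \<circ> adj i)) + c k * G k (\<tau>, w)" if "k \<in> K" for k
    using arg_cong[OF eq[OF that], of "\<lambda>x. c k * x"] by (simp add: algebra_simps)
  then show "(gap \<tau> i + 1) * (\<Sum>k\<in>K. c k * G k (\<tau> \<circ> adj i, w)) =
      gap \<tau> i * (\<Sum>k\<in>K. c k * G k (\<tau>, w \<circ> adj i)) + (\<Sum>k\<in>K. c k * G k (\<tau>, w))"
    unfolding sum_distrib_left sum.distrib[symmetric] by (intro sum.cong refl)
qed

lemma F_const: "(\<lambda>_. c) \<in> F"
  by (simp add: F_def exch_def algebra_simps)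

lemma exch_left:
  assumes "exch i G" "v \<in> S"
  shows "exch i (\<lambda>(\<tau>, w). G (\<tau>, v \<circ> w))"
  unfolding exch_def
proof (intro ballI)
  fix \<tau> w assume t: "\<tau> \<in> S" "w \<in> S"
  show "(gap \<tau> i + 1) * (case (\<tau> \<circ> adj i, w) of (\<tau>, w) \<Rightarrow> G (\<tau>, v \<circ> w)) =
      gap \<tau> i * (case (\<tau>, w \<circ> adj i) of (\<tau>, w) \<Rightarrow> G (\<tau>, v \<circ> w)) +
      (case (\<tau>, w) of (\<tau>, w) \<Rightarrow> G (\<tau>, v \<circ> w))"
    using exchD[OF assms(1) t(1) S_comp[OF assms(2) t(2)]] by (simp add: o_assoc)
qed

lemma F_left: "G \<in> F \<Longrightarrow> v \<in> S \<Longrightarrow> (\<lambda>(\<tau>, w). G (\<tau>, v \<circ> w)) \<in> F"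
  by (simp add: F_def exch_left)

lemma F_cnj:
  assumes "G \<in> F"
  shows "(\<lambda>x. cnj (G x)) \<in> F"
  unfolding F_def exch_def
proof (intro CollectI allI impI ballI)
  fix i \<tau> w assume "Suc i < N" and t: "\<tau> \<in> S" "w \<in> S"
  then have "cnj ((gap \<tau> i + 1) * G (\<tau> \<circ> adj i, w)) = cnj (gap \<tau> i * G (\<tau>, w \<circ> adj i) + G (\<tau>, w))"
    using exchD[OF F_exch[OF assms]] by simp
  moreover have "cnj (gap \<tau> i) = gap \<tau> i" by (simp add: gap_def)
  ultimately show "(gap \<tau> i + 1) * cnj (G (\<tau> \<circ> adj i, w)) =
      gap \<tau> i * cnj (G (\<tau>, w \<circ> adj i)) + cnj (G (\<tau>, w))"
    by simp
qed

text \<open>Solving the relation for the value at \<open>w \<circ> adj i\<close> divides by the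
  nonzero gap, so zeros spread over the coset of \<open>w\<close>. The parameters \<open>T\<close>
  and \<open>m\<close> allow for subgroups and for functions that fail one relation.\<close>

lemma exch_vanish_right:
  assumes m: "m \<le> N" and ex: "\<And>i. Suc i < N \<Longrightarrow> Suc i \<noteq> m \<Longrightarrow> exch i G"
    and T: "T \<subseteq> S" "\<And>\<tau> i. \<tau> \<in> T \<Longrightarrow> Suc i < N \<Longrightarrow> Suc i \<noteq> m \<Longrightarrow> \<tau> \<circ> adj i \<in> T"
    and w: "w \<in> S" and 0: "\<And>\<tau>. \<tau> \<in> T \<Longrightarrow> G (\<tau>, w) = 0" and v: "v \<in> block_perms N m"
  shows "\<tau> \<in> T \<Longrightarrow> G (\<tau>, w \<circ> v) = 0"
  using v m
proof (induction v arbitrary: \<tau> rule: block_perms_induct)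
  case id
  then show ?case using 0 by simp
next
  case (adj v i)
  have t: "\<tau> \<in> S" "w \<circ> v \<in> S"
    using adj.prems T(1) S_comp[OF w block_perms_S[OF adj.hyps(1)]] by auto
  have "gap \<tau> i * G (\<tau>, w \<circ> v \<circ> adj i) = 0"
    using exchD[OF ex[OF adj.hyps(2,3)] t] adj.IH[OF adj.prems] adj.IH[OF T(2)[OF adj.prems adj.hyps(2,3)]]
    by simp
  then have "G (\<tau>, w \<circ> v \<circ> adj i) = 0" using gap_nz(1)[OF t(1) adj.hyps(2)] by simp
  then show ?case by (simp only: o_assoc)
qed

lemma F_eqI:
  assumes "G \<in> F" "H \<in> F" "w \<in> S" "\<And>\<tau>. \<tau> \<in> S \<Longrightarrow> G (\<tau>, w) = H (\<tau>, w)"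
    and t: "\<tau> \<in> S" "v \<in> S"
  shows "G (\<tau>, v) = H (\<tau>, v)"
proof -
  define u where "u = pinv w \<circ> v"
  have "u \<in> S" using assms by (simp add: S_iff u_def permutes_compose permutes_inv)
  moreover have "w \<circ> u = v"
    using permutes_surj[of w "{..<N}"] assms(3) by (simp add: S_iff u_def fun_eq_iff surj_f_inv_f)
  moreover have "G (\<tau>, w \<circ> u) - 1 * H (\<tau>, w \<circ> u) = 0"
    by (rule exch_vanish_right[of 0 _ S]) (use F_exch[OF F_diff[OF assms(1,2), of 1]] assms(3,4) t \<open>u \<in> S\<close> in
      \<open>auto simp: block_perms_0_eq\<close>)
  ultimately show ?thesis by simp
qed

text \<open>The counterpart in the other argument: solve for the value at
  \<open>\<tau> \<circ> adj i\<close> and divide by \<open>gap \<tau> i + 1\<close>.\<close>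

lemma F_vanish_left:
  assumes G: "G \<in> F" and t: "\<tau> \<in> S" and 0: "\<And>w. w \<in> S \<Longrightarrow> G (\<tau>, w) = 0" and v: "v \<in> S"
  shows "w \<in> S \<Longrightarrow> G (\<tau> \<circ> v, w) = 0"
proof -
  have "v \<in> block_perms N 0" using v by (simp add: block_perms_0_eq)
  then show "w \<in> S \<Longrightarrow> G (\<tau> \<circ> v, w) = 0"
    using le0
  proof (induction v arbitrary: w rule: block_perms_induct)
    case id
    then show ?case using 0 by simp
  next
    case (adj v i)
    have tv: "\<tau> \<circ> v \<in> S" using S_comp[OF t block_perms_S[OF adj.hyps(1)]] .
    have "(gap (\<tau> \<circ> v) i + 1) * G (\<tau> \<circ> v \<circ> adj i, w) = 0"
      using exchD[OF F_exch[OF G adj.hyps(2)] tv adj.prems] adj.IH[OF adj.prems]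
        adj.IH[OF S_adj[OF adj.prems adj.hyps(2)]]
      by simp
    then have "G (\<tau> \<circ> v \<circ> adj i, w) = 0" using gap_nz(2)[OF tv adj.hyps(2)] by simp
    then show ?case by (simp only: o_assoc)
  qed
qed

section \<open>Solutions with prescribed values at the identity\<close>

definition inv_coeff :: "nat \<Rightarrow> nat \<Rightarrow> (nat \<Rightarrow> nat) \<Rightarrow> complex"
  where "inv_coeff a c w = of_bool (pinv w a < pinv w c) - of_bool (a < c)"

text \<open>The polynomial generators of the degenerate affine Hecke algebra; they act on \<open>G (\<tau>, id)\<close> as
  multiplication by \<open>z (\<tau> a)\<close>, so Lagrange interpolation shows that \<open>G (\<tau>, id)\<close> can be prescribed arbitrarily.\<close>

definition X :: "nat \<Rightarrow> ((nat \<Rightarrow> nat) \<times> (nat \<Rightarrow> nat) \<Rightarrow> complex) \<Rightarrow> (nat \<Rightarrow> nat) \<times> (nat \<Rightarrow> nat) \<Rightarrow> complex"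
  where "X a G = (\<lambda>(\<tau>, w). complex_of_real (z (\<tau> (pinv w a))) * G (\<tau>, w) +
    (\<Sum>c<N. inv_coeff a c w * G (\<tau>, transpose a c \<circ> w)))"

text \<open>Multiplication by \<open>z\<close> at the place of \<open>a\<close> violates the
  relation only if \<open>adj i\<close> moves that place. The label \<open>c\<close> in the other
  place then changes its order relative to \<open>a\<close>, and the jump of
  \<open>inv_coeff a c\<close> makes up the defect.\<close>

lemma X_F:
  assumes G: "G \<in> F" and a: "a < N"
  shows "X a G \<in> F"
  unfolding F_def exch_def
proof (intro CollectI allI impI ballI)
  fix i \<tau> w assume i: "Suc i < N" and t: "\<tau> \<in> S" and w: "w \<in> S"
  let ?s = "adj i" and ?u = "gap \<tau> i"
  define p where "p = pinv w a"
  have bw: "bij w" using w permutes_bij by (auto simp: S_iff)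
  have wp: "w p = a" unfolding p_def using bw by (simp add: bij_is_surj surj_f_inv_f)
  have inv_adj: "pinv (w \<circ> ?s) c = ?s (pinv w c)" for c
    using bw by (simp add: o_inv_distrib)
  \<comment> \<open>The direction in which \<open>adj i\<close> moves the place of \<open>a\<close>:
    1 up, -1 down, 0 if it is fixed.\<close>
  define e :: complex where "e = of_bool (p < ?s p) - of_bool (?s p < p)"
  have zp: "complex_of_real (z (\<tau> p)) - complex_of_real (z (\<tau> (?s p))) = ?u * e"
    by (auto simp: e_def gap_def transpose_def)
  have term_c: "(gap \<tau> i + 1) * (inv_coeff a c w * G (\<tau> \<circ> ?s, transpose a c \<circ> w)) =
      ?u * (inv_coeff a c (w \<circ> ?s) * G (\<tau>, transpose a c \<circ> (w \<circ> ?s))) + inv_coeff a c w * G (\<tau>, transpose a c \<circ> w)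
      + (if c = w (?s p) then ?u * e * G (\<tau>, w) else 0)" if c: "c < N" for c
  proof -
    have tw: "transpose a c \<circ> w \<in> S"
      using w a c by (auto simp: S_iff intro!: permutes_compose permutes_swap_id)
    have ex: "(?u + 1) * G (\<tau> \<circ> ?s, transpose a c \<circ> w) =
        ?u * G (\<tau>, transpose a c \<circ> (w \<circ> ?s)) + G (\<tau>, transpose a c \<circ> w)"
      using exchD[OF F_exch[OF G i] t tw] by (simp add: o_assoc)
    have "(inv_coeff a c w - inv_coeff a c (w \<circ> ?s)) * G (\<tau>, transpose a c \<circ> (w \<circ> ?s)) =
        (if c = w (?s p) then e * G (\<tau>, w) else 0)"
    proof (cases "c = w (?s p)")
      case True
      then have ic: "pinv w c = ?s p" using bw by (simp add: bij_is_inj)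
      have co: "inv_coeff a c w - inv_coeff a c (w \<circ> ?s) = e"
        by (simp add: inv_coeff_def inv_adj ic p_def[symmetric] e_def)
      show ?thesis
      proof (cases "?s p = p")
        case True
        then show ?thesis using co by (simp add: e_def)
      next
        case False
        \<comment> \<open>Exchanging the labels in the two neighbouring places undoes
          \<open>adj i\<close>.\<close>
        have "transpose a c \<circ> (w \<circ> ?s) = w"
        proof
          fix x
          have "?s p = (if p = i then Suc i else i)" "p = i \<or> p = Suc i"
            using False by (auto simp: transpose_def split: if_splits)
          then show "(transpose a c \<circ> (w \<circ> ?s)) x = w x"
            unfolding \<open>c = w (?s p)\<close> wp[symmetric]
            by (auto simp: transpose_def S_inj[OF w])
        qed
        then show ?thesis using co \<open>c = w (?s p)\<close> by simp
      qed
    next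
      case False
      have "pinv w c \<noteq> ?s p" using False bw by (metis bij_inv_eq_iff)
      then have "inv_coeff a c w = inv_coeff a c (w \<circ> ?s)"
        unfolding inv_coeff_def inv_adj p_def[symmetric] by (auto simp: transpose_def split: if_splits)
      then show ?thesis using False by simp
    qed
    with ex show ?thesis by (auto simp: algebra_simps)
  qed
  \<comment> \<open>Multiplication by \<open>y\<close> and \<open>y'\<close> misses the term
    \<open>u * e * g3\<close>, which the sums supply.\<close>
  have combine: "(u + 1) * (y' * g1 + A) = u * (y' * g2 + B) + (y * g3 + C)"
    if "(u + 1) * g1 = u * g2 + g3" "(u + 1) * A = u * B + C + u * e * g3" "y - y' = u * e"
    for u y y' g1 g2 g3 A B C :: complex
  proof -
    have "(u + 1) * (y' * g1 + A) = y' * ((u + 1) * g1) + (u + 1) * A" by (simp add: algebra_simps)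
    also have "\<dots> = y' * (u * g2 + g3) + (u * B + C + (y - y') * g3)" by (simp only: that)
    finally show ?thesis by (simp add: algebra_simps)
  qed
  have sp: "w (?s p) < N"
  proof -
    have "p < N" using a w wp by (metis S_iff lessThan_iff permutes_in_image)
    then show ?thesis using i by (auto simp: transpose_def intro!: S_less[OF w])
  qed
  have "(gap \<tau> i + 1) * (\<Sum>c<N. inv_coeff a c w * G (\<tau> \<circ> ?s, transpose a c \<circ> w)) =
      ?u * (\<Sum>c<N. inv_coeff a c (w \<circ> ?s) * G (\<tau>, transpose a c \<circ> (w \<circ> ?s))) +
      (\<Sum>c<N. inv_coeff a c w * G (\<tau>, transpose a c \<circ> w)) + (\<Sum>c<N. if c = w (?s p) then ?u * e * G (\<tau>, w) else 0)"
    unfolding sum_distrib_left sum.distrib[symmetric] by (intro sum.cong refl term_c) simp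
  also have "(\<Sum>c<N. if c = w (?s p) then ?u * e * G (\<tau>, w) else 0) = ?u * e * G (\<tau>, w)"
    using sp by simp
  finally have sums: "(gap \<tau> i + 1) * (\<Sum>c<N. inv_coeff a c w * G (\<tau> \<circ> ?s, transpose a c \<circ> w)) =
      ?u * (\<Sum>c<N. inv_coeff a c (w \<circ> ?s) * G (\<tau>, transpose a c \<circ> (w \<circ> ?s))) +
      (\<Sum>c<N. inv_coeff a c w * G (\<tau>, transpose a c \<circ> w)) + ?u * e * G (\<tau>, w)" .
  have "(?u + 1) * G (\<tau> \<circ> ?s, w) = ?u * G (\<tau>, w \<circ> ?s) + G (\<tau>, w)"
    using exchD[OF F_exch[OF G i] t w] .
  from combine[OF this sums zp]
  show "(?u + 1) * X a G (\<tau> \<circ> ?s, w) = ?u * X a G (\<tau>, w \<circ> ?s) + X a G (\<tau>, w)"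
    by (simp only: X_def prod.case inv_adj p_def[symmetric] o_apply)
qed

lemma X_id: "X a G (\<tau>, id) = complex_of_real (z (\<tau> a)) * G (\<tau>, id)"
  by (simp add: X_def inv_coeff_def)

lemma delta_exists:
  assumes s: "\<sigma> \<in> S"
  shows "\<exists>G\<in>F. \<forall>\<tau>\<in>S. G (\<tau>, id) = of_bool (\<tau> = \<sigma>)"
proof -
  let ?f = "\<lambda>\<tau> (a, k). complex_of_real (z (\<tau> a)) - complex_of_real (z k)"
  have ex: "\<exists>G\<in>F. \<forall>\<tau>. G (\<tau>, id) = (\<Prod>x\<in>A. ?f \<tau> x)" if "finite A" "A \<subseteq> {..<N} \<times> UNIV" for A
    using that
  proof (induction A rule: finite_induct)
    case empty
    then show ?case using F_const[of 1] by (intro bexI[of _ "\<lambda>_. 1"]) auto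
  next
    case (insert x A)
    obtain a k where x: "x = (a, k)" by force
    then have a: "a < N" using insert by simp
    from insert obtain G where G: "G \<in> F" "\<forall>\<tau>. G (\<tau>, id) = (\<Prod>x\<in>A. ?f \<tau> x)" by blast
    have "(\<lambda>y. X a G y - complex_of_real (z k) * G y) \<in> F"
      using G a by (intro F_diff X_F)
    moreover have "\<forall>\<tau>. X a G (\<tau>, id) - complex_of_real (z k) * G (\<tau>, id) = (\<Prod>x\<in>insert x A. ?f \<tau> x)"
      using insert.hyps G x by (simp add: X_id algebra_simps)
    ultimately show ?case by (intro bexI)
  qed
  \<comment> \<open>No factor \<open>z (\<tau> a) - z k\<close> with
    \<open>k \<noteq> \<sigma> a\<close> vanishes at \<open>\<tau> = \<sigma>\<close>; any other
    \<open>\<tau>\<close> in \<open>S\<close> makes one vanish, at a place where it differs from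
    \<open>\<sigma>\<close>.\<close>
  define A where "A = Sigma {..<N} (\<lambda>a. {..<N} - {\<sigma> a})"
  have "finite A" "A \<subseteq> {..<N} \<times> UNIV" by (auto simp: A_def)
  from ex[OF this] obtain G where G: "G \<in> F" "\<And>\<tau>. G (\<tau>, id) = (\<Prod>x\<in>A. ?f \<tau> x)" by auto
  have nz: "G (\<sigma>, id) \<noteq> 0"
    unfolding G(2) using z_inj S_less[OF s] by (auto simp: A_def)
  have z: "G (\<tau>, id) = 0" if "\<tau> \<in> S" "\<tau> \<noteq> \<sigma>" for \<tau>
  proof -
    obtain a where a: "\<tau> a \<noteq> \<sigma> a" using \<open>\<tau> \<noteq> \<sigma>\<close> by auto
    then have "a < N" using that s by (metis S_iff lessThan_iff permutes_not_in)
    then have "(a, \<tau> a) \<in> A" using a S_less[OF that(1)] by (auto simp: A_def)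
    then show ?thesis
      unfolding G(2) using \<open>finite A\<close> by (intro prod_zero bexI) auto
  qed
  \<comment> \<open>Normalization to the value 1, written as a difference to fit
    \<open>F_diff\<close>.\<close>
  have "(\<lambda>x. 0 - (- inverse (G (\<sigma>, id))) * G x) \<in> F"
    using F_const G by (intro F_diff)
  then show ?thesis using nz z by (intro bexI) auto
qed

definition delta :: "(nat \<Rightarrow> nat) \<Rightarrow> (nat \<Rightarrow> nat) \<times> (nat \<Rightarrow> nat) \<Rightarrow> complex"
  where "delta \<sigma> = (SOME G. G \<in> F \<and> (\<forall>\<tau>\<in>S. G (\<tau>, id) = of_bool (\<tau> = \<sigma>)))"

lemma delta:
  assumes "\<sigma> \<in> S"
  shows "delta \<sigma> \<in> F" "\<tau> \<in> S \<Longrightarrow> delta \<sigma> (\<tau>, id) = of_bool (\<tau> = \<sigma>)"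
proof -
  have "\<exists>G. G \<in> F \<and> (\<forall>\<tau>\<in>S. G (\<tau>, id) = of_bool (\<tau> = \<sigma>))"
    using delta_exists[OF assms] by blast
  from someI_ex[OF this] show "delta \<sigma> \<in> F" "\<tau> \<in> S \<Longrightarrow> delta \<sigma> (\<tau>, id) = of_bool (\<tau> = \<sigma>)"
    unfolding delta_def by auto
qed

end

section \<open>A positive pairing\<close>

lemma inv_count_le_comp_adj:
  assumes v: "v permutes {..<N}" and i: "Suc i < N"
  shows "inv_count N v \<le> Suc (inv_count N (v \<circ> adj i))"
proof (cases "v i < v (Suc i)")
  case True
  then show ?thesis using inv_count_comp_adj[OF i True] by simp
next
  case False
  have "v i \<noteq> v (Suc i)" using permutes_inj[OF v] by (metis injD n_not_Suc_n)
  then have "(v \<circ> adj i) i < (v \<circ> adj i) (Suc i)" using False by simp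
  from inv_count_comp_adj[OF i this] show ?thesis by (simp only: comp_adj_adj)
qed

context exchange
begin

text \<open>Bilinear; complex conjugation enters through \<open>H\<close>. With \<open>m = 0\<close>
  and \<open>H\<close> the conjugate of \<open>G\<close> it is the form \<open>B\<close> of the
  overview.\<close>

definition pairing where
  "pairing m G H \<tau> = (\<Sum>v\<in>block_perms N m. G (\<tau>, v) * H (\<tau> \<circ> block_rev N m, v \<circ> block_rev N m) :: complex)"

text \<open>The reversal gives the relation for \<open>H\<close> the gap \<open>- ?u\<close>. In the
  product the mixed terms cancel after reindexing by \<open>adj i\<close>, and
  \<open>(1 + ?u) * (1 - ?u)\<close> times the old pairing remains.\<close>

lemma pairing_adj:
  assumes G: "G \<in> F" and H: "H \<in> F" and m: "m \<le> N" and i: "Suc i < N" "Suc i \<noteq> m" and t: "\<tau> \<in> S"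
  shows "pairing m G H (\<tau> \<circ> adj i) = pairing m G H \<tau>"
proof -
  let ?P = "block_perms N m" and ?r = "block_rev N m" and ?s = "adj i" and ?u = "gap \<tau> i"
  define H' where "H' \<tau> v = H (\<tau> \<circ> ?r, v \<circ> ?r)" for \<tau> v
  define i' where "i' = ?r (Suc i)"
  note i' = block_rev_adj[OF m i, folded i'_def]
  have r: "?r \<in> S" using block_rev_block_perms[OF m] by (rule block_perms_S)
  have gap': "gap (\<tau> \<circ> ?r) i' = - ?u"
    using m unfolding gap_def o_apply i'(3) by (simp add: i'_def)
  have exH: "(1 - ?u) * H' (\<tau> \<circ> ?s) v = - ?u * H' \<tau> (v \<circ> ?s) + H' \<tau> v" if v: "v \<in> S" for v
  proof -
    have c: "w \<circ> ?r \<circ> adj i' = w \<circ> ?s \<circ> ?r" for w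
      by (simp only: o_assoc[symmetric] i'(4))
    show ?thesis
      using exchD[OF F_exch[OF H i'(1)] S_comp[OF t r] S_comp[OF v r]]
      unfolding c gap' H'_def by (simp only: add.commute diff_conv_add_uminus)
  qed
  have exG: "(1 + ?u) * G (\<tau> \<circ> ?s, v) = ?u * G (\<tau>, v \<circ> ?s) + G (\<tau>, v)" if v: "v \<in> S" for v
    using exchD[OF F_exch[OF G i(1)] t v] by (simp add: add.commute)
  have re: "(\<Sum>v\<in>?P. f (v \<circ> ?s)) = sum f ?P" for f :: "_ \<Rightarrow> complex"
    by (rule sum.reindex_bij_witness[of _ "\<lambda>v. v \<circ> ?s" "\<lambda>v. v \<circ> ?s"])
      (use adj_block_perms[OF i] in \<open>auto intro: block_perms_comp\<close>)
  let ?A = "\<Sum>v\<in>?P. G (\<tau>, v) * H' \<tau> v"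
  let ?B = "\<Sum>v\<in>?P. G (\<tau>, v \<circ> ?s) * H' \<tau> v"
  have A: "(\<Sum>v\<in>?P. G (\<tau>, v \<circ> ?s) * H' \<tau> (v \<circ> ?s)) = ?A"
    by (rule re)
  have B: "(\<Sum>v\<in>?P. G (\<tau>, v) * H' \<tau> (v \<circ> ?s)) = ?B"
    using re[of "\<lambda>v. G (\<tau>, v \<circ> ?s) * H' \<tau> v"] by simp
  have "((1 + ?u) * (1 - ?u)) * (\<Sum>v\<in>?P. G (\<tau> \<circ> ?s, v) * H' (\<tau> \<circ> ?s) v) =
      (\<Sum>v\<in>?P. ((1 + ?u) * G (\<tau> \<circ> ?s, v)) * ((1 - ?u) * H' (\<tau> \<circ> ?s) v))"
    unfolding sum_distrib_left by (intro sum.cong refl) (simp only: mult_ac)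
  also have "\<dots> = (\<Sum>v\<in>?P. (?u * G (\<tau>, v \<circ> ?s) + G (\<tau>, v)) * (- ?u * H' \<tau> (v \<circ> ?s) + H' \<tau> v))"
    by (intro sum.cong refl) (simp only: exG exH block_perms_S)
  also have "\<dots> = - ?u * ?u * (\<Sum>v\<in>?P. G (\<tau>, v \<circ> ?s) * H' \<tau> (v \<circ> ?s)) + ?u * ?B
      - ?u * (\<Sum>v\<in>?P. G (\<tau>, v) * H' \<tau> (v \<circ> ?s)) + ?A"
    unfolding sum_distrib_left sum_subtractf[symmetric] sum.distrib[symmetric]
    by (intro sum.cong refl) (simp add: algebra_simps)
  also have "\<dots> = ((1 + ?u) * (1 - ?u)) * ?A"
    unfolding A B by (simp add: algebra_simps)
  finally have "(\<Sum>v\<in>?P. G (\<tau> \<circ> ?s, v) * H' (\<tau> \<circ> ?s) v) = ?A"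
    using gap_nz(2,3)[OF t i(1)] by (simp add: add.commute)
  then show ?thesis by (simp only: pairing_def H'_def)
qed

lemma pairing_block:
  assumes G: "G \<in> F" and H: "H \<in> F" and m: "m \<le> N" and t: "\<tau> \<in> S" and s: "\<sigma> \<in> block_perms N m"
  shows "pairing m G H (\<tau> \<circ> \<sigma>) = pairing m G H \<tau>"
  using s m
proof (induction \<sigma> rule: block_perms_induct)
  case id
  then show ?case by (simp only: comp_id)
next
  case (adj v i)
  show ?case
    using pairing_adj[OF G H m adj.hyps(2,3) S_comp[OF t block_perms_S[OF adj.hyps(1)]]] adj.IH
    by (simp only: o_assoc)
qed

text \<open>The strict bound makes \<open>1 + 1 / x\<close> positive for each difference
  \<open>x\<close> of two points in one block.\<close>

definition separated :: "nat \<Rightarrow> (nat \<Rightarrow> nat) \<Rightarrow> bool"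
  where "separated m \<tau> \<longleftrightarrow> (\<forall>a<N. \<forall>b<N. a \<noteq> b \<and> (a < m \<longleftrightarrow> b < m) \<longrightarrow> \<bar>z (\<tau> a) - z (\<tau> b)\<bar> > 1)"

lemma separated_comp:
  assumes s: "separated m \<tau>" and v: "v \<in> block_perms N m" and m: "m \<le> N"
  shows "separated m (\<tau> \<circ> v)"
  using s block_perms_lt_iff[OF v m] S_less[OF block_perms_S[OF v]] S_inj[OF block_perms_S[OF v]]
  by (simp add: separated_def)

text \<open>Each exchange changes the inversion number by one, so \<open>delta \<kappa> (\<cdot>, v)\<close> is supported on permutations with
  fewer inversions than \<open>v\<close>, apart from \<open>\<kappa> \<circ> v\<close> itself.\<close>

lemma delta_triangular:
  assumes k: "\<kappa> \<in> S" and sep: "separated m \<kappa>" and m: "m \<le> N" and v: "v \<in> block_perms N m"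
  shows "(\<forall>\<rho>\<in>block_perms N m. delta \<kappa> (\<kappa> \<circ> \<rho>, v) \<noteq> 0 \<longrightarrow> \<rho> = v \<or> inv_count N \<rho> < inv_count N v) \<and>
    (\<exists>r>0. delta \<kappa> (\<kappa> \<circ> v, v) = complex_of_real r)"
  using v m
proof (induction v rule: block_perms_induct)
  case id
  have inj: "\<kappa> \<circ> \<rho> = \<kappa> \<Longrightarrow> \<rho> = id" for \<rho>
    using S_inj[OF k] by (auto simp: fun_eq_iff)
  have "delta \<kappa> (\<kappa> \<circ> id, id) = complex_of_real 1"
    using delta(2)[OF k k] by (simp only: comp_id) simp
  then have "\<exists>r>0. delta \<kappa> (\<kappa> \<circ> id, id) = complex_of_real r"
    by (intro exI[of _ 1]) simp
  moreover have "\<rho> = id" if "\<rho> \<in> block_perms N m" "delta \<kappa> (\<kappa> \<circ> \<rho>, id) \<noteq> 0" for \<rho>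
    using delta(2)[OF k S_comp[OF k block_perms_S[OF that(1)]]] that(2) inj by (auto split: if_splits)
  ultimately show ?case by blast
next
  case (adj v i)
  note i = adj.hyps(2,3)
  have vS: "v \<in> S" using adj.hyps(1) by (rule block_perms_S)
  have ic: "inv_count N (v \<circ> adj i) = Suc (inv_count N v)"
    by (rule inv_count_comp_adj) fact+
  \<comment> \<open>The relation solved for the value at the longer permutation
    \<open>v \<circ> adj i\<close>.\<close>
  have step: "gap (\<kappa> \<circ> \<rho>) i * delta \<kappa> (\<kappa> \<circ> \<rho>, v \<circ> adj i) =
      (gap (\<kappa> \<circ> \<rho>) i + 1) * delta \<kappa> (\<kappa> \<circ> (\<rho> \<circ> adj i), v) - delta \<kappa> (\<kappa> \<circ> \<rho>, v)" if "\<rho> \<in> S" for \<rho>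
    using exchD[OF F_exch[OF delta(1)[OF k] i(1)] S_comp[OF k that] vS] by (simp add: o_assoc)
  have *: "\<rho> = v \<circ> adj i \<or> inv_count N \<rho> < inv_count N (v \<circ> adj i)"
    if r: "\<rho> \<in> block_perms N m" and nz: "delta \<kappa> (\<kappa> \<circ> \<rho>, v \<circ> adj i) \<noteq> 0" for \<rho>
  proof -
    have rS: "\<rho> \<in> S" using r by (rule block_perms_S)
    have "gap (\<kappa> \<circ> \<rho>) i \<noteq> 0" using gap_nz(1)[OF S_comp[OF k rS] i(1)] .
    with nz step[OF rS] have "delta \<kappa> (\<kappa> \<circ> (\<rho> \<circ> adj i), v) \<noteq> 0 \<or> delta \<kappa> (\<kappa> \<circ> \<rho>, v) \<noteq> 0"
      by auto
    then consider "\<rho> \<circ> adj i = v" | "inv_count N (\<rho> \<circ> adj i) < inv_count N v" | "\<rho> = v"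
      | "inv_count N \<rho> < inv_count N v"
      using adj.IH r block_perms_comp[OF r adj_block_perms[OF i]] by metis
    then show ?thesis
    proof cases
      case 1
      then show ?thesis using comp_adj_adj[of \<rho> i] by simp
    next
      case 2
      then show ?thesis using inv_count_le_comp_adj[of \<rho> N i] rS i(1) ic by (simp add: S_iff)
    qed (use ic in auto)
  qed
  let ?w = "v \<circ> adj i"
  have w: "?w \<in> block_perms N m" "?w \<in> S"
    using block_perms_comp[OF adj.hyps(1) adj_block_perms[OF i]] block_perms_S by auto
  \<comment> \<open>\<open>?w\<close> is longer than \<open>v\<close>, so only the entry at
    \<open>?w \<circ> adj i = v\<close> feeds the new leading entry.\<close>
  have "delta \<kappa> (\<kappa> \<circ> ?w, v) = 0"
    using adj.IH w(1) ic by (metis less_Suc_eq not_less_iff_gr_or_eq)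
  moreover obtain r where r: "r > 0" "delta \<kappa> (\<kappa> \<circ> v, v) = complex_of_real r"
    using adj.IH by blast
  ultimately have eq: "gap (\<kappa> \<circ> ?w) i * delta \<kappa> (\<kappa> \<circ> ?w, ?w) = (gap (\<kappa> \<circ> ?w) i + 1) * complex_of_real r"
    using step[OF w(2)] by (simp only: comp_adj_adj) simp
  define x where "x = z ((\<kappa> \<circ> ?w) i) - z ((\<kappa> \<circ> ?w) (Suc i))"
  \<comment> \<open>As \<open>Suc i \<noteq> m\<close>, both indices lie in one block; the factor
    \<open>(x + 1) / x\<close> gained by the leading entry is therefore positive.\<close>
  have "\<bar>x\<bar> > 1"
    using separated_comp[OF sep w(1) m, unfolded separated_def, rule_format, of i "Suc i"] i
      Suc_leI[of i m]
    unfolding x_def by fastforce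
  then have pos: "(x + 1) / x * r > 0"
    using r(1) by (intro mult_pos_pos) (auto simp: zero_less_divide_iff)
  have "delta \<kappa> (\<kappa> \<circ> ?w, ?w) = complex_of_real ((x + 1) / x * r)"
    using eq gap_nz(1)[OF S_comp[OF k w(2)] i(1)]
    unfolding gap_def x_def[symmetric] by (simp add: field_simps)
  with pos * show ?case by blast
qed

text \<open>Since the pairing does not change along the block permutations, it may be evaluated on \<open>delta (\<tau> \<circ> \<sigma>)\<close> at
  \<open>\<tau> \<circ> \<sigma> \<circ> block_rev N m\<close>, where only the longest element contributes.\<close>

lemma pairing_diagonal:
  assumes t: "\<tau> \<in> S" and sep: "separated m \<tau>" and m: "m \<le> N"
  obtains M :: "(nat \<Rightarrow> nat) \<Rightarrow> real" where "\<And>\<sigma>. \<sigma> \<in> block_perms N m \<Longrightarrow> M \<sigma> > 0"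
    "\<And>G H. G \<in> F \<Longrightarrow> H \<in> F \<Longrightarrow> pairing m G H \<tau> =
      (\<Sum>\<sigma>\<in>block_perms N m. complex_of_real (M \<sigma>) * (G (\<tau> \<circ> \<sigma>, id) * H (\<tau> \<circ> \<sigma>, id)))"
proof -
  let ?P = "block_perms N m" and ?r = "block_rev N m"
  have rP: "?r \<in> ?P" using m by (rule block_rev_block_perms)
  have ts: "\<tau> \<circ> \<sigma> \<in> S" "separated m (\<tau> \<circ> \<sigma>)" if "\<sigma> \<in> ?P" for \<sigma>
    using S_comp[OF t block_perms_S[OF that]] separated_comp[OF sep that m] by auto
  have "\<exists>r>0. delta (\<tau> \<circ> \<sigma>) (\<tau> \<circ> \<sigma> \<circ> ?r, ?r) = complex_of_real r" if "\<sigma> \<in> ?P" for \<sigma>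
    using delta_triangular[OF ts[OF that] m rP] by blast
  then obtain M :: "(nat \<Rightarrow> nat) \<Rightarrow> real" where M: "\<And>\<sigma>. \<sigma> \<in> ?P \<Longrightarrow> M \<sigma> > 0"
    "\<And>\<sigma>. \<sigma> \<in> ?P \<Longrightarrow> delta (\<tau> \<circ> \<sigma>) (\<tau> \<circ> \<sigma> \<circ> ?r, ?r) = complex_of_real (M \<sigma>)"
    by metis
  have pd: "pairing m (delta (\<tau> \<circ> \<sigma>)) H \<tau> = complex_of_real (M \<sigma>) * H (\<tau> \<circ> \<sigma>, id)"
    if s: "\<sigma> \<in> ?P" and H: "H \<in> F" for \<sigma> H
  proof -
    \<comment> \<open>No block permutation is longer than \<open>?r\<close>, so \<open>?r\<close> is
      neither \<open>v\<close> nor shorter than \<open>v\<close>.\<close>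
    have 0: "delta (\<tau> \<circ> \<sigma>) (\<tau> \<circ> \<sigma> \<circ> ?r, v) = 0" if "v \<in> ?P" "v \<noteq> ?r" for v
      using delta_triangular[OF ts[OF s] m that(1)] rP that(2) inv_count_le_block_rev[OF that(1) m]
      by fastforce
    have "pairing m (delta (\<tau> \<circ> \<sigma>)) H \<tau> = pairing m (delta (\<tau> \<circ> \<sigma>)) H (\<tau> \<circ> \<sigma> \<circ> ?r)"
      using pairing_block[OF delta(1)[OF ts(1)[OF s]] H m t block_perms_comp[OF s rP]]
      by (simp only: o_assoc)
    also have "\<dots> = (\<Sum>v\<in>?P. if v = ?r then complex_of_real (M \<sigma>) * H (\<tau> \<circ> \<sigma>, id) else 0)"
      unfolding pairing_def
    proof (intro sum.cong refl)
      fix v assume v: "v \<in> ?P"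
      show "delta (\<tau> \<circ> \<sigma>) (\<tau> \<circ> \<sigma> \<circ> ?r, v) * H (\<tau> \<circ> \<sigma> \<circ> ?r \<circ> ?r, v \<circ> ?r) =
          (if v = ?r then complex_of_real (M \<sigma>) * H (\<tau> \<circ> \<sigma>, id) else 0)"
      proof (cases "v = ?r")
        case True
        show ?thesis unfolding True by (simp only: M(2)[OF s] block_rev_comp[OF m] simp_thms if_True)
      next
        case False
        show ?thesis by (simp only: 0[OF v False] False if_False mult_zero_left)
      qed
    qed
    also have "\<dots> = complex_of_real (M \<sigma>) * H (\<tau> \<circ> \<sigma>, id)"
      by (subst sum.delta) (use rP in auto)
    finally show ?thesis .
  qed
  have expand: "G (\<tau>, v) = (\<Sum>\<sigma>\<in>?P. G (\<tau> \<circ> \<sigma>, id) * delta (\<tau> \<circ> \<sigma>) (\<tau>, v))"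
    if G: "G \<in> F" and v: "v \<in> ?P" for G v
  proof -
    let ?E = "\<lambda>x. \<Sum>\<sigma>\<in>?P. G (\<tau> \<circ> \<sigma>, id) * delta (\<tau> \<circ> \<sigma>) x"
    have E: "?E \<in> F" by (rule F_sum) (use delta(1) ts in blast)
    have inj: "\<tau> \<circ> \<rho> = \<tau> \<circ> \<sigma> \<longleftrightarrow> \<rho> = \<sigma>" for \<rho> \<sigma>
      using S_inj[OF t] by (auto simp: fun_eq_iff)
    have 0: "G (\<tau> \<circ> \<rho>, id) - 1 * ?E (\<tau> \<circ> \<rho>, id) = 0" if r: "\<rho> \<in> ?P" for \<rho>
    proof -
      have "?E (\<tau> \<circ> \<rho>, id) = (\<Sum>\<sigma>\<in>?P. if \<sigma> = \<rho> then G (\<tau> \<circ> \<rho>, id) else 0)"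
        by (intro sum.cong refl) (auto simp: delta(2)[OF ts(1) ts(1)[OF r]] inj)
      then show ?thesis using r by simp
    qed
    have "G (\<tau>, id \<circ> v) - 1 * ?E (\<tau>, id \<circ> v) = 0"
    \<comment> \<open>As \<open>v\<close> is a block permutation, agreement on the coset of
      \<open>\<tau>\<close> is enough.\<close>
    proof (rule exch_vanish_right[where T = "(\<lambda>\<rho>. \<tau> \<circ> \<rho>) ` ?P"])
      show "exch i (\<lambda>x. G x - 1 * ?E x)" if "Suc i < N" for i
        by (rule F_exch[OF F_diff[OF G E] that])
      show "(\<lambda>\<rho>. \<tau> \<circ> \<rho>) ` ?P \<subseteq> S" using ts(1) by blast
      show "\<kappa> \<circ> adj i \<in> (\<lambda>\<rho>. \<tau> \<circ> \<rho>) ` ?P" if "\<kappa> \<in> (\<lambda>\<rho>. \<tau> \<circ> \<rho>) ` ?P" "Suc i < N" "Suc i \<noteq> m" for \<kappa> i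
        using that block_perms_comp[OF _ adj_block_perms[OF that(2,3)]] by (auto simp: o_assoc[symmetric])
      show "G (\<kappa>, id) - 1 * ?E (\<kappa>, id) = 0" if "\<kappa> \<in> (\<lambda>\<rho>. \<tau> \<circ> \<rho>) ` ?P" for \<kappa>
        using that 0 by blast
      show "\<tau> \<in> (\<lambda>\<rho>. \<tau> \<circ> \<rho>) ` ?P" using id_block_perms by (metis comp_id imageI)
      show "v \<in> block_perms N m" by (rule v)
    qed (rule m, rule id_S)
    then show ?thesis by (simp only: id_comp mult_1_left eq_iff_diff_eq_0[symmetric])
  qed
  have "pairing m G H \<tau> = (\<Sum>\<sigma>\<in>?P. complex_of_real (M \<sigma>) * (G (\<tau> \<circ> \<sigma>, id) * H (\<tau> \<circ> \<sigma>, id)))"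
    if G: "G \<in> F" and H: "H \<in> F" for G H
  proof -
    have "pairing m G H \<tau> = (\<Sum>v\<in>?P. \<Sum>\<sigma>\<in>?P. G (\<tau> \<circ> \<sigma>, id) * (delta (\<tau> \<circ> \<sigma>) (\<tau>, v) * H (\<tau> \<circ> ?r, v \<circ> ?r)))"
      unfolding pairing_def
      by (intro sum.cong refl, subst expand[OF G], assumption) (simp only: sum_distrib_right mult.assoc)
    also have "\<dots> = (\<Sum>\<sigma>\<in>?P. G (\<tau> \<circ> \<sigma>, id) * pairing m (delta (\<tau> \<circ> \<sigma>)) H \<tau>)"
      unfolding pairing_def sum_distrib_left by (rule sum.swap)
    also have "\<dots> = (\<Sum>\<sigma>\<in>?P. complex_of_real (M \<sigma>) * (G (\<tau> \<circ> \<sigma>, id) * H (\<tau> \<circ> \<sigma>, id)))"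
      by (intro sum.cong refl) (simp only: pd[OF _ H] mult_ac)
    finally show ?thesis .
  qed
  with M(1) show thesis by (rule that)
qed

text \<open>Summed over right translates by block permutations, the expression splits into pairings
  of left translates of \<open>G\<close> with their conjugates. If it were 0, positivity of the
  diagonal form would give \<open>G (\<tau>, w) = 0\<close> for all \<open>w\<close> in
  \<open>S\<close>, and \<open>F_vanish_left\<close> then makes \<open>G\<close> vanish on all pairs
  from \<open>S\<close>.\<close>

lemma weighted_pairing_nonzero:
  fixes q :: "(nat \<Rightarrow> nat) \<Rightarrow> real"
  assumes G: "G \<in> F" and nz: "\<exists>\<tau>\<in>S. \<exists>w\<in>S. G (\<tau>, w) \<noteq> 0"
    and t: "\<tau> \<in> S" and sep: "separated m \<tau>" and m: "m \<le> N"
    and q_pos: "\<And>w. w \<in> S \<Longrightarrow> q w > 0"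
    and q_inv: "\<And>w v. w \<in> S \<Longrightarrow> v \<in> block_perms N m \<Longrightarrow> q (w \<circ> v) = q w"
  shows "(\<Sum>w\<in>S. complex_of_real (q w) * (G (\<tau>, w) * cnj (G (\<tau> \<circ> block_rev N m, w \<circ> block_rev N m)))) \<noteq> 0"
    (is "?E \<noteq> 0")
proof
  assume E0: "?E = 0"
  let ?P = "block_perms N m" and ?r = "block_rev N m"
  let ?f = "\<lambda>w. complex_of_real (q w) * (G (\<tau>, w) * cnj (G (\<tau> \<circ> ?r, w \<circ> ?r)))"
  obtain M where M: "\<And>\<sigma>. \<sigma> \<in> ?P \<Longrightarrow> M \<sigma> > 0"
    "\<And>G H. G \<in> F \<Longrightarrow> H \<in> F \<Longrightarrow> pairing m G H \<tau> =
      (\<Sum>\<sigma>\<in>?P. complex_of_real (M \<sigma>) * (G (\<tau> \<circ> \<sigma>, id) * H (\<tau> \<circ> \<sigma>, id)))"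
    by (rule pairing_diagonal[OF t sep m]) blast
  have shift: "(\<Sum>w\<in>S. ?f (w \<circ> v)) = ?E" if v: "v \<in> ?P" for v
  proof -
    have vp: "v permutes {..<N}" using v by (rule block_perms_permutes)
    have "w \<circ> v \<circ> pinv v = w" "w \<circ> pinv v \<circ> v = w" for w
      using permutes_inv_o[OF vp] by (simp_all only: o_assoc[symmetric] comp_id)
    moreover have "pinv v \<in> S" using vp by (simp add: S_iff permutes_inv)
    ultimately show ?thesis
      using block_perms_S[OF v]
      by (intro sum.reindex_bij_witness[of _ "\<lambda>w. w \<circ> pinv v" "\<lambda>w. w \<circ> v"]) auto
  qed
  have inner: "(\<Sum>v\<in>?P. ?f (w \<circ> v)) = complex_of_real (q w * (\<Sum>\<sigma>\<in>?P. M \<sigma> * (cmod (G (\<tau> \<circ> \<sigma>, w)))\<^sup>2))"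
    if w: "w \<in> S" for w
  proof -
    let ?G = "\<lambda>(\<tau>, v). G (\<tau>, w \<circ> v)"
    have "(\<Sum>v\<in>?P. ?f (w \<circ> v)) = complex_of_real (q w) * pairing m ?G (\<lambda>x. cnj (?G x)) \<tau>"
      unfolding pairing_def sum_distrib_left
      by (intro sum.cong refl) (simp only: q_inv[OF w] prod.case o_assoc)
    also have "\<dots> = complex_of_real (q w) *
        (\<Sum>\<sigma>\<in>?P. complex_of_real (M \<sigma>) * (G (\<tau> \<circ> \<sigma>, w) * cnj (G (\<tau> \<circ> \<sigma>, w))))"
      using M(2)[OF F_left[OF G w] F_cnj[OF F_left[OF G w]]] by (simp only: prod.case comp_id)
    finally show ?thesis
      by (simp only: of_real_mult of_real_sum complex_norm_square)
  qed
  have "0 = (\<Sum>v\<in>?P. \<Sum>w\<in>S. ?f (w \<circ> v))"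
    by (rule sym, rule sum.neutral, rule ballI) (simp only: shift E0)
  also have "\<dots> = (\<Sum>w\<in>S. complex_of_real (q w * (\<Sum>\<sigma>\<in>?P. M \<sigma> * (cmod (G (\<tau> \<circ> \<sigma>, w)))\<^sup>2)))"
    by (subst sum.swap) (intro sum.cong refl inner)
  also have "\<dots> = complex_of_real (\<Sum>w\<in>S. q w * (\<Sum>\<sigma>\<in>?P. M \<sigma> * (cmod (G (\<tau> \<circ> \<sigma>, w)))\<^sup>2))"
    by (rule of_real_sum[symmetric])
  finally have "complex_of_real (\<Sum>w\<in>S. q w * (\<Sum>\<sigma>\<in>?P. M \<sigma> * (cmod (G (\<tau> \<circ> \<sigma>, w)))\<^sup>2)) = 0"
    by (rule sym)
  then have "(\<Sum>w\<in>S. q w * (\<Sum>\<sigma>\<in>?P. M \<sigma> * (cmod (G (\<tau> \<circ> \<sigma>, w)))\<^sup>2)) = 0"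
    by (simp only: of_real_eq_0_iff)
  moreover have nonneg: "M \<sigma> * (cmod (G (\<tau> \<circ> \<sigma>, w)))\<^sup>2 \<ge> 0" if "\<sigma> \<in> ?P" for w \<sigma>
    using M(1)[OF that] by simp
  moreover have "q w * (\<Sum>\<sigma>\<in>?P. M \<sigma> * (cmod (G (\<tau> \<circ> \<sigma>, w)))\<^sup>2) \<ge> 0" if "w \<in> S" for w
    by (rule mult_nonneg_nonneg[OF less_imp_le[OF q_pos[OF that]] sum_nonneg[OF nonneg]])
  ultimately have q0: "q w * (\<Sum>\<sigma>\<in>?P. M \<sigma> * (cmod (G (\<tau> \<circ> \<sigma>, w)))\<^sup>2) = 0" if "w \<in> S" for w
    using that sum_nonneg_eq_0_iff[of S "\<lambda>w. q w * (\<Sum>\<sigma>\<in>?P. M \<sigma> * (cmod (G (\<tau> \<circ> \<sigma>, w)))\<^sup>2)"]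
    by simp
  have "(\<Sum>\<sigma>\<in>?P. M \<sigma> * (cmod (G (\<tau> \<circ> \<sigma>, w)))\<^sup>2) = 0" if "w \<in> S" for w
    using q0[OF that] q_pos[OF that] by simp
  then have "M id * (cmod (G (\<tau> \<circ> id, w)))\<^sup>2 = 0" if "w \<in> S" for w
    using that nonneg by (subst (asm) sum_nonneg_eq_0_iff) (auto simp del: comp_id)
  then have 0: "G (\<tau>, w) = 0" if "w \<in> S" for w
    using that M(1)[OF id_block_perms] by force
  obtain \<kappa> w where kw: "\<kappa> \<in> S" "w \<in> S" "G (\<kappa>, w) \<noteq> 0" using nz by blast
  have tp: "\<tau> permutes {..<N}" using t by (simp add: S_iff)
  have "pinv \<tau> \<circ> \<kappa> \<in> S" using kw(1) tp by (simp add: S_iff permutes_inv permutes_compose)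
  from F_vanish_left[OF G t 0 this kw(2)] have "G (\<tau> \<circ> (pinv \<tau> \<circ> \<kappa>), w) = 0" .
  moreover have "\<tau> \<circ> (pinv \<tau> \<circ> \<kappa>) = \<kappa>"
    using permutes_inv_o(1)[OF tp] by (simp only: o_assoc id_comp)
  ultimately show False using kw(3) by simp
qed

end

section \<open>Commuting cyclic operators\<close>

text \<open>Two rotations take the last two places to the first two.\<close>

lemma adj_0_cyc_cyc:
  "N = Suc (Suc n) \<Longrightarrow> adj 0 \<circ> cyc N 1 \<circ> cyc N 1 = cyc N 1 \<circ> cyc N 1 \<circ> adj n"
  by (auto simp: fun_eq_iff cyc_1 transpose_def simp del: One_nat_def)

context exchange
begin

text \<open>Zero values outside \<open>S\<close> turn agreement of solutions into equality of
  functions, as \<open>joint_eigenvector\<close> requires.\<close>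

definition V :: "((nat \<Rightarrow> nat) \<times> (nat \<Rightarrow> nat) \<Rightarrow> complex) set"
  where "V = {G \<in> F. \<forall>\<tau> w. \<not> (\<tau> \<in> S \<and> w \<in> S) \<longrightarrow> G (\<tau>, w) = 0}"

definition cut :: "((nat \<Rightarrow> nat) \<times> (nat \<Rightarrow> nat) \<Rightarrow> complex) \<Rightarrow> (nat \<Rightarrow> nat) \<times> (nat \<Rightarrow> nat) \<Rightarrow> complex"
  where "cut G = (\<lambda>(\<tau>, w). if \<tau> \<in> S \<and> w \<in> S then G (\<tau>, w) else 0)"

lemma cut_apply: "\<tau> \<in> S \<Longrightarrow> w \<in> S \<Longrightarrow> cut G (\<tau>, w) = G (\<tau>, w)"
  by (simp add: cut_def)

lemma cut_V: "G \<in> F \<Longrightarrow> cut G \<in> V"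
  by (simp add: V_def F_def exch_def cut_def)

lemma V_F: "G \<in> V \<Longrightarrow> G \<in> F"
  by (simp add: V_def)

lemma V_diff: "G \<in> V \<Longrightarrow> H \<in> V \<Longrightarrow> (\<lambda>x. G x - c * H x) \<in> V"
  unfolding V_def using F_diff by simp

lemma V_eqI:
  assumes "G \<in> V" "H \<in> V" "w \<in> S" "\<And>\<tau>. \<tau> \<in> S \<Longrightarrow> G (\<tau>, w) = H (\<tau>, w)"
  shows "G = H"
proof (rule ext, clarify)
  fix \<tau> v
  show "G (\<tau>, v) = H (\<tau>, v)"
    using F_eqI[OF V_F[OF assms(1)] V_F[OF assms(2)] assms(3,4)] assms(1,2)
    by (cases "\<tau> \<in> S \<and> v \<in> S") (auto simp: V_def)
qed

lemma cyc_S [simp]: "cyc N k \<in> S"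
  by (simp add: S_iff cyc_permutes)

lemma transpose_S: "a < N \<Longrightarrow> c < N \<Longrightarrow> transpose a c \<in> S"
  by (simp add: S_iff permutes_swap_id)

text \<open>Rotation shifts the index of an adjacent transposition by one. Index 0 is left out: its
  transposition changes \<open>\<tau> 0\<close>.\<close>

lemma exch_cyc:
  assumes G: "G \<in> F" and i: "Suc (Suc i) < N"
  shows "exch (Suc i) (\<lambda>(\<tau>, w). b (\<tau> 0) * G (\<tau> \<circ> cyc N 1, w \<circ> cyc N 1))"
  unfolding exch_def
proof (intro ballI)
  fix \<tau> w assume t: "\<tau> \<in> S" "w \<in> S"
  let ?c = "cyc N 1"
  have c: "v \<circ> ?c \<circ> adj i = v \<circ> adj (Suc i) \<circ> ?c" for v
    by (simp only: o_assoc[symmetric] adj_cyc[OF i])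
  have "gap (\<tau> \<circ> ?c) i = gap \<tau> (Suc i)"
    using i by (simp add: gap_def cyc_1 del: One_nat_def)
  then have "(gap \<tau> (Suc i) + 1) * G (\<tau> \<circ> adj (Suc i) \<circ> ?c, w \<circ> ?c) =
      gap \<tau> (Suc i) * G (\<tau> \<circ> ?c, w \<circ> adj (Suc i) \<circ> ?c) + G (\<tau> \<circ> ?c, w \<circ> ?c)"
    using exchD[OF F_exch[OF G] S_comp[OF t(1) cyc_S] S_comp[OF t(2) cyc_S], of i 1 1] i
    by (simp only: c)
  from arg_cong[OF this, of "\<lambda>x. b (\<tau> 0) * x"]
  show "(gap \<tau> (Suc i) + 1) * (case (\<tau> \<circ> adj (Suc i), w) of (\<tau>, w) \<Rightarrow> b (\<tau> 0) * G (\<tau> \<circ> ?c, w \<circ> ?c)) =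
      gap \<tau> (Suc i) * (case (\<tau>, w \<circ> adj (Suc i)) of (\<tau>, w) \<Rightarrow> b (\<tau> 0) * G (\<tau> \<circ> ?c, w \<circ> ?c)) +
      (case (\<tau>, w) of (\<tau>, w) \<Rightarrow> b (\<tau> 0) * G (\<tau> \<circ> ?c, w \<circ> ?c))"
    by (simp add: algebra_simps del: One_nat_def)
qed

text \<open>\<open>Y b a G\<close> is the unique member of \<open>F\<close> that agrees with \<open>b (\<tau> 0) * G (\<tau> \<circ> cyc N 1, w \<circ> cyc N 1)\<close> whenever
  \<open>w 0 = a\<close>.\<close>

definition Y :: "(nat \<Rightarrow> complex) \<Rightarrow> nat \<Rightarrow> ((nat \<Rightarrow> nat) \<times> (nat \<Rightarrow> nat) \<Rightarrow> complex) \<Rightarrow> (nat \<Rightarrow> nat) \<times> (nat \<Rightarrow> nat) \<Rightarrow> complex"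
  where "Y b a G = cut (\<lambda>x. \<Sum>\<sigma>\<in>S. b (\<sigma> 0) * G (\<sigma> \<circ> cyc N 1, transpose 0 a \<circ> cyc N 1) *
    (case x of (\<tau>, w) \<Rightarrow> delta \<sigma> (\<tau>, transpose 0 a \<circ> w)))"

lemma Y_V:
  assumes "a < N"
  shows "Y b a G \<in> V"
  unfolding Y_def
  by (intro cut_V F_sum F_left delta(1) transpose_S) (use assms in auto)

lemma Y_lin: "Y b a (\<lambda>x. G x - c * H x) = (\<lambda>x. Y b a G x - c * Y b a H x)"
  by (auto simp: Y_def cut_def fun_eq_iff left_diff_distrib right_diff_distrib sum_subtractf
      sum_distrib_left mult_ac simp del: One_nat_def)

text \<open>The \<open>w\<close> with \<open>w 0 = a\<close> form the coset of
  \<open>transpose 0 a\<close> under the block permutations for \<open>m = 1\<close>. Both sides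
  agree at \<open>transpose 0 a\<close> and obey the relations of nonzero index, so the agreement
  spreads.\<close>

lemma Y_apply:
  assumes G: "G \<in> F" and a: "a < N" and t: "\<tau> \<in> S" and w: "w \<in> S" "w 0 = a"
  shows "Y b a G (\<tau>, w) = b (\<tau> 0) * G (\<tau> \<circ> cyc N 1, w \<circ> cyc N 1)"
proof -
  let ?c = "cyc N 1" and ?wa = "transpose 0 a"
  let ?H = "\<lambda>(\<tau>, w). b (\<tau> 0) * G (\<tau> \<circ> ?c, w \<circ> ?c)"
  have N: "0 < N" using a by simp
  have wa: "?wa \<in> S" using transpose_S[OF N a] .
  define v where "v = ?wa \<circ> w"
  have v: "v \<in> block_perms N 1"
    using S_comp[OF wa w(1)] w(2) by (simp add: v_def block_perms_def S_iff)
  have "Y b a G (\<tau>, ?wa \<circ> v) - 1 * ?H (\<tau>, ?wa \<circ> v) = 0"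
  proof (rule exch_vanish_right[where T = S])
    show "exch i (\<lambda>x. Y b a G x - 1 * ?H x)" if i: "Suc i < N" "Suc i \<noteq> 1" for i
    proof -
      obtain j where j: "i = Suc j" using i by (cases i) auto
      show ?thesis
        using exch_diff[OF F_exch[OF V_F[OF Y_V[OF a]] i(1)] exch_cyc[OF G i(1)[unfolded j], folded j]] .
    qed
    show "Y b a G (\<tau>, ?wa) - 1 * ?H (\<tau>, ?wa) = 0" if t: "\<tau> \<in> S" for \<tau>
    proof -
      have "Y b a G (\<tau>, ?wa) = (\<Sum>\<sigma>\<in>S. if \<sigma> = \<tau> then b (\<tau> 0) * G (\<tau> \<circ> ?c, ?wa \<circ> ?c) else 0)"
        unfolding Y_def cut_apply[OF t wa] prod.case transpose_comp_involutory
        by (intro sum.cong refl) (use delta(2) t in auto)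
      then show ?thesis using t by simp
    qed
  qed (use N wa t v in auto)
  moreover have "?wa \<circ> v = w" by (simp add: v_def o_assoc)
  ultimately show ?thesis by simp
qed

lemma Y_Y_apply:
  assumes G: "G \<in> F" and a: "a < N" "a' < N" and t: "\<tau> \<in> S" and w: "w \<in> S" "w 0 = a" "w 1 = a'" and N: "1 < N"
  shows "Y b a (Y b a' G) (\<tau>, w) =
    b (\<tau> 0) * b (\<tau> 1) * G (\<tau> \<circ> cyc N 1 \<circ> cyc N 1, w \<circ> cyc N 1 \<circ> cyc N 1)"
proof -
  have c0: "cyc N 1 0 = 1" using N by (simp add: cyc_1 del: One_nat_def)
  have "(w \<circ> cyc N 1) 0 = a'" using w(3) c0 by simp
  from Y_apply[of G a' "\<tau> \<circ> cyc N 1" "w \<circ> cyc N 1" b, OF G a(2) S_comp[OF t cyc_S] S_comp[OF w(1) cyc_S] this]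
  show ?thesis
    unfolding Y_apply[OF V_F[OF Y_V[OF a(2)]] a(1) t w(1,2)] by (simp only: o_apply c0 mult.assoc)
qed

text \<open>It suffices to compare at one \<open>w\<close> with \<open>a\<close> in place 0 and
  \<open>a'\<close> in place 1. There one order is explicit; the other is explicit at
  \<open>w \<circ> adj 0\<close>, and the relation of index 0 carries it to
  \<open>w\<close>.\<close>

lemma Y_commute:
  assumes G: "G \<in> F" and a: "a < N" "a' < N"
  shows "Y b a (Y b a' G) = Y b a' (Y b a G)"
proof (cases "a = a'")
  case False
  \<comment> \<open>Chosen so that \<open>transpose 0 a\<close> sends \<open>x\<close> to
    \<open>a'\<close>.\<close>
  define x where "x = transpose 0 a a'"
  define w where "w = transpose 0 a \<circ> transpose 1 x"
  have N: "1 < N" using a False by linarith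
  define n where "n = N - 2"
  have n: "N = Suc (Suc n)" and N': "Suc 0 < N" and n': "Suc n < N"
    using N by (simp_all add: n_def)
  have x: "x < N" "x \<noteq> 0" using a False by (auto simp: x_def transpose_def)
  have w: "w \<in> S" "w 0 = a" "w 1 = a'"
  proof -
    show "w \<in> S" unfolding w_def using x(1) a(1) N by (intro S_comp transpose_S) auto
    show "w 0 = a" unfolding w_def using x(2) by simp
    show "w 1 = a'" unfolding w_def by (simp add: x_def del: One_nat_def)
  qed
  have ws: "w \<circ> adj 0 \<in> S" "(w \<circ> adj 0) 0 = a'" "(w \<circ> adj 0) 1 = a"
    using S_adj[OF w(1), of 0] w(2,3) N by simp_all
  let ?cc = "cyc N 1 \<circ> cyc N 1"
  show ?thesis
  proof (rule V_eqI[OF Y_V[OF a(1)] Y_V[OF a(2)] w(1)])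
    fix \<tau> assume t: "\<tau> \<in> S"
    let ?u = "gap \<tau> 0" and ?H = "Y b a' (Y b a G)"
    have ts: "\<tau> \<circ> adj 0 \<in> S" using S_adj[OF t, of 0] N by simp
    have cc: "v \<circ> adj 0 \<circ> cyc N 1 \<circ> cyc N 1 = v \<circ> cyc N 1 \<circ> cyc N 1 \<circ> adj n" for v
      using arg_cong[OF adj_0_cyc_cyc[OF n], of "\<lambda>f. v \<circ> f"] by (simp only: o_assoc)
    have gap_cc: "gap (\<tau> \<circ> cyc N 1 \<circ> cyc N 1) n = ?u"
      by (simp add: gap_def cyc_1 n del: One_nat_def)
    have 1: "(?u + 1) * ?H (\<tau> \<circ> adj 0, w \<circ> adj 0) = ?u * ?H (\<tau>, w) + ?H (\<tau>, w \<circ> adj 0)"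
      using exchD[OF F_exch[OF V_F[OF Y_V[OF a(2)]] N'] t ws(1)] by (simp only: comp_adj_adj)
    let ?G = "\<lambda>\<tau> w. G (\<tau> \<circ> cyc N 1 \<circ> cyc N 1, w \<circ> cyc N 1 \<circ> cyc N 1)"
    \<comment> \<open>The relation of \<open>G\<close> in the last two places, read through two
      rotations, has the same gap as relation \<open>1\<close>.\<close>
    have 2: "(?u + 1) * ?G (\<tau> \<circ> adj 0) (w \<circ> adj 0) = ?u * ?G \<tau> w + ?G \<tau> (w \<circ> adj 0)"
    proof -
      have "\<tau> \<circ> cyc N 1 \<circ> cyc N 1 \<in> S" "w \<circ> adj 0 \<circ> cyc N 1 \<circ> cyc N 1 \<in> S"
        using S_comp[OF S_comp[OF t cyc_S] cyc_S] S_comp[OF S_comp[OF ws(1) cyc_S] cyc_S] .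
      from exchD[OF F_exch[OF G n'] this] show ?thesis
        by (simp only: gap_cc cc comp_adj_adj)
    qed
    have H: "?H (\<tau>, w \<circ> adj 0) = b (\<tau> 0) * b (\<tau> 1) * ?G \<tau> (w \<circ> adj 0)"
      "?H (\<tau> \<circ> adj 0, w \<circ> adj 0) = b (\<tau> 1) * b (\<tau> 0) * ?G (\<tau> \<circ> adj 0) (w \<circ> adj 0)"
      using Y_Y_apply[of G a' a \<tau> "w \<circ> adj 0" b, OF G a(2,1) t ws N]
        Y_Y_apply[of G a' a "\<tau> \<circ> adj 0" "w \<circ> adj 0" b, OF G a(2,1) ts ws N]
      by simp_all
    have "?u * ?H (\<tau>, w) = ?u * (b (\<tau> 0) * b (\<tau> 1) * ?G \<tau> w)"
    proof -
      have "?u * ?H (\<tau>, w) = (?u + 1) * ?H (\<tau> \<circ> adj 0, w \<circ> adj 0) - ?H (\<tau>, w \<circ> adj 0)"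
        using 1 by (simp only: add_diff_cancel_right')
      also have "\<dots> = b (\<tau> 0) * b (\<tau> 1) * ((?u + 1) * ?G (\<tau> \<circ> adj 0) (w \<circ> adj 0) - ?G \<tau> (w \<circ> adj 0))"
        unfolding H right_diff_distrib by (simp only: mult_ac)
      also have "\<dots> = b (\<tau> 0) * b (\<tau> 1) * (?u * ?G \<tau> w)"
        unfolding 2 by (simp only: add_diff_cancel_right')
      finally show ?thesis by (simp only: mult_ac)
    qed
    then have "?H (\<tau>, w) = b (\<tau> 0) * b (\<tau> 1) * ?G \<tau> w"
      using gap_nz(1)[OF t, of 0] n by simp
    then show "Y b a (Y b a' G) (\<tau>, w) = ?H (\<tau>, w)"
      using Y_Y_apply[OF G a t w N] by simp
  qed
qed simp

section \<open>Solutions depending on the place of one label\<close>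

definition rat :: "nat \<Rightarrow> nat \<Rightarrow> complex"
  where "rat x y = complex_of_real ((z x - z y + 1) / (z x - z y))"

text \<open>\<open>W g A y\<close> is the value of a solution that depends only on the position of one label, when \<open>A\<close> is the set
  of points before that label and \<open>y\<close> is the point at its position.\<close>

definition W :: "(nat \<Rightarrow> complex) \<Rightarrow> nat set \<Rightarrow> nat \<Rightarrow> complex"
  where "W g A y = (\<Sum>x\<in>A. g x / complex_of_real (z y - z x) * (\<Prod>t\<in>A - {x}. rat t x)) + g y * (\<Prod>t\<in>A. rat t y)"

text \<open>The terms of \<open>A\<close> match by partial fractions in three points; the term of
  \<open>x\<close> in the enlarged set cancels the last summand of \<open>W g A x\<close>.\<close>

lemma W_insert:
  assumes A: "A \<subseteq> {..<N}" and x: "x < N" "x \<notin> A" and y: "y < N" "y \<notin> A" and xy: "x \<noteq> y"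
  defines "u \<equiv> complex_of_real (z x - z y)"
  shows "(u + 1) * W g A y = u * W g (insert x A) y + W g A x"
proof -
  have fin: "finite A" using A finite_subset by blast
  have zxy: "z x \<noteq> z y" using z_inj[OF x(1) y(1) xy] .
  then have u0: "u \<noteq> 0" by (simp add: u_def)
  have rxy: "u * rat x y = u + 1"
    using zxy by (simp add: u_def rat_def)
  have last: "u * (g x / complex_of_real (z y - z x)) = - g x"
    using zxy by (simp add: u_def field_simps)
  have term_t: "(u + 1) * (g t / complex_of_real (z y - z t) * (\<Prod>s\<in>A - {t}. rat s t)) =
      u * (g t / complex_of_real (z y - z t) * (\<Prod>s\<in>insert x A - {t}. rat s t)) +
      g t / complex_of_real (z x - z t) * (\<Prod>s\<in>A - {t}. rat s t)" if t: "t \<in> A" for t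
  proof -
    have "insert x A - {t} = insert x (A - {t})" using t x by auto
    then have p: "(\<Prod>s\<in>insert x A - {t}. rat s t) = rat x t * (\<Prod>s\<in>A - {t}. rat s t)"
      using fin x by simp
    have tz: "z y \<noteq> z t" "z x \<noteq> z t"
      using z_inj[of y t] z_inj[of x t] t x y A by auto
    have "(z x - z y + 1) / (z y - z t) = (z x - z y) * ((z x - z t + 1) / (z x - z t)) / (z y - z t) + 1 / (z x - z t)"
      using tz by (simp add: divide_simps) (simp add: algebra_simps)
    from arg_cong[OF this, of complex_of_real]
    have "(u + 1) / complex_of_real (z y - z t) = u * rat x t / complex_of_real (z y - z t) + 1 / complex_of_real (z x - z t)"
      by (simp add: u_def rat_def)
    from arg_cong[OF this, of "\<lambda>c. c * (g t * (\<Prod>s\<in>A - {t}. rat s t))"]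
    show ?thesis unfolding p by (simp add: algebra_simps)
  qed
  have Ax: "insert x A - {x} = A" using x by auto
  have "(u + 1) * W g A y = (\<Sum>t\<in>A. (u + 1) * (g t / complex_of_real (z y - z t) * (\<Prod>s\<in>A - {t}. rat s t)))
      + (u + 1) * (g y * (\<Prod>t\<in>A. rat t y))"
    by (simp only: W_def distrib_left sum_distrib_left)
  also have "\<dots> = (\<Sum>t\<in>A. u * (g t / complex_of_real (z y - z t) * (\<Prod>s\<in>insert x A - {t}. rat s t)))
      + (\<Sum>t\<in>A. g t / complex_of_real (z x - z t) * (\<Prod>s\<in>A - {t}. rat s t)) + u * rat x y * (g y * (\<Prod>t\<in>A. rat t y))"
    unfolding sum.distrib[symmetric] rxy by (intro arg_cong2[where f = "(+)"] sum.cong refl term_t)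
  also have "\<dots> = u * W g (insert x A) y + W g A x"
    unfolding W_def sum.insert[OF fin x(2)] prod.insert[OF fin x(2)] Ax distrib_left sum_distrib_left
    using arg_cong[OF last, of "\<lambda>c. c * (\<Prod>t\<in>A. rat t x)"] by (simp add: algebra_simps)
  finally show ?thesis .
qed

lemma W_cong:
  "A \<subseteq> {..<N} \<Longrightarrow> y < N \<Longrightarrow> (\<And>k. k < N \<Longrightarrow> f k = g k) \<Longrightarrow> W f A y = W g A y"
  unfolding W_def by (intro arg_cong2[where f = "(+)"] sum.cong) auto

lemma W_diff: "W (\<lambda>k. f k - c * g k) A y = W f A y - c * W g A y"
  by (simp add: W_def diff_divide_distrib left_diff_distrib sum_subtractf sum_distrib_left algebra_simps)

definition Wfun :: "nat \<Rightarrow> (nat \<Rightarrow> complex) \<Rightarrow> (nat \<Rightarrow> nat) \<times> (nat \<Rightarrow> nat) \<Rightarrow> complex"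
  where "Wfun a g = (\<lambda>(\<tau>, w). W g (\<tau> ` {..<pinv w a}) (\<tau> (pinv w a)))"

lemma pinv_less: "w \<in> S \<Longrightarrow> a < N \<Longrightarrow> pinv w a < N"
  using S_less[of "pinv w" a] by (simp add: S_iff permutes_inv)

lemma pinv_eq: "w \<in> S \<Longrightarrow> w p = a \<Longrightarrow> pinv w a = p"
  by (auto simp: S_iff permutes_inj inv_f_f)

text \<open>With the label in place \<open>i\<close> the relation is \<open>W_insert\<close>. With
  the label in place \<open>Suc i\<close> it follows by eliminating \<open>?R\<close> from that
  relation at \<open>\<tau>\<close> and at \<open>\<tau> \<circ> adj i\<close>.\<close>

lemma Wfun_F:
  assumes a: "a < N"
  shows "Wfun a g \<in> F"
  unfolding F_def exch_def
proof (intro CollectI allI impI ballI)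
  fix i \<tau> w assume i: "Suc i < N" and t: "\<tau> \<in> S" and w: "w \<in> S"
  let ?s = "adj i" and ?u = "gap \<tau> i"
  define p where "p = pinv w a"
  have p: "p < N" using pinv_less[OF w a] by (simp add: p_def)
  have bw: "bij w" using w permutes_bij by (auto simp: S_iff)
  have inv_adj: "pinv (w \<circ> ?s) a = ?s p"
    using bw by (simp add: o_inv_distrib p_def)
  have base: "(gap \<kappa> i + 1) * W g (\<kappa> ` {..<i}) (\<kappa> (Suc i)) =
      gap \<kappa> i * W g (insert (\<kappa> i) (\<kappa> ` {..<i})) (\<kappa> (Suc i)) + W g (\<kappa> ` {..<i}) (\<kappa> i)" if k: "\<kappa> \<in> S" for \<kappa>
    unfolding gap_def
    by (rule W_insert) (use i S_less[OF k] S_inj[OF k] in auto)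
  have "(?u + 1) * W g ((\<tau> \<circ> ?s) ` {..<p}) ((\<tau> \<circ> ?s) p) = ?u * W g (\<tau> ` {..<?s p}) (\<tau> (?s p)) + W g (\<tau> ` {..<p}) (\<tau> p)"
  proof -
    have im: "?s ` {..<k} = {..<k}" if "k \<noteq> Suc i" for k
    proof (cases "k \<le> i")
      case True
      then show ?thesis by (auto simp: transpose_def image_iff)
    next
      case False
      then have "i < k" "Suc i < k" using that by auto
      then show ?thesis by (simp add: transpose_image_eq)
    qed
    have ims: "(\<tau> \<circ> ?s) ` {..<k} = \<tau> ` {..<k}" if "k \<noteq> Suc i" for k
      by (simp only: image_comp[symmetric] im[OF that])
    consider "p = i" | "p = Suc i" | "p \<noteq> i" "p \<noteq> Suc i" by blast
    then show ?thesis
    proof cases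
      case 1
      then show ?thesis using base[OF t] ims[of i] by (simp add: lessThan_Suc)
    next
      case 2
      let ?A = "\<tau> ` {..<i}"
      let ?P = "W g ?A (\<tau> i)" and ?R = "W g ?A (\<tau> (Suc i))"
      let ?C = "W g (insert (\<tau> i) ?A) (\<tau> (Suc i))" and ?D = "W g (insert (\<tau> (Suc i)) ?A) (\<tau> i)"
      have B1: "(?u + 1) * ?R = ?u * ?C + ?P" by (rule base[OF t])
      have B2: "(- ?u + 1) * ?P = - ?u * ?D + ?R"
        using base[OF S_adj[OF t i]] ims[of i] by (simp add: gap_adj)
      have "?u * ((?u + 1) * ?D) = (?u + 1) * ?R - (?u + 1) * ((- ?u + 1) * ?P)"
        unfolding B2 by (simp add: algebra_simps)
      also have "\<dots> = ?u * (?u * ?P + ?C)"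
        unfolding B1 by (simp add: algebra_simps)
      finally have "(?u + 1) * ?D = ?u * ?P + ?C"
        using gap_nz(1)[OF t i] by simp
      moreover have "(\<tau> \<circ> ?s) ` {..<Suc i} = insert (\<tau> (Suc i)) ?A"
        using ims[of i] by (simp add: lessThan_Suc)
      ultimately show ?thesis using 2 by (simp add: lessThan_Suc)
    next
      case 3
      then have "?s p = p" by (simp add: transpose_def)
      then show ?thesis using ims[OF 3(2)] by (simp add: algebra_simps)
    qed
  qed
  then show "(?u + 1) * Wfun a g (\<tau> \<circ> ?s, w) = ?u * Wfun a g (\<tau>, w \<circ> ?s) + Wfun a g (\<tau>, w)"
    by (simp only: Wfun_def prod.case inv_adj p_def[symmetric])
qed

text \<open>The real factor called mu in the overview.\<close>

definition weight :: "nat \<Rightarrow> complex"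
  where "weight x = (\<Prod>t\<in>{..<N} - {x}. rat t x)"

lemma weight_nz: "x < N \<Longrightarrow> weight x \<noteq> 0"
proof -
  assume x: "x < N"
  have "rat t x \<noteq> 0" if "t < N" "t \<noteq> x" for t
    using z_inj[OF that(1) x that(2)] z_gap[OF x that(1)] by (simp add: rat_def del: of_real_divide)
  then show ?thesis by (auto simp: weight_def)
qed

lemma weight_Reals: "weight x \<in> \<real>"
  unfolding weight_def rat_def by (intro prod_in_Reals) auto

text \<open>This is where the matrix appears: the factor \<open>rat k x\<close> of
  \<open>weight x\<close> turns the denominator \<open>z k - z x\<close> into
  \<open>z k - z x + 1\<close>.\<close>

lemma W_full:
  assumes k: "k < N"
  shows "W g ({..<N} - {k}) k = (\<Sum>x<N. weight x / complex_of_real (z k - z x + 1) * g x)"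
proof -
  have "g x / complex_of_real (z k - z x) * (\<Prod>t\<in>{..<N} - {k} - {x}. rat t x) =
      weight x / complex_of_real (z k - z x + 1) * g x" if x: "x \<in> {..<N} - {k}" for x
  proof -
    have "{..<N} - {x} = insert k ({..<N} - {k} - {x})" using x k by auto
    then have w: "weight x = rat k x * (\<Prod>t\<in>{..<N} - {k} - {x}. rat t x)"
      by (simp add: weight_def)
    have "z k - z x \<noteq> 0" "z k - z x + 1 \<noteq> 0"
      using z_inj[of k x] z_gap[of x k] x k by auto
    then have eq: "(z k - z x + 1) / (z k - z x) / (z k - z x + 1) = 1 / (z k - z x)"
      by simp
    have "rat k x / complex_of_real (z k - z x + 1) = 1 / complex_of_real (z k - z x)"
      unfolding rat_def of_real_divide[symmetric] eq by simp
    from arg_cong[OF this, of "\<lambda>c. c * (g x * (\<Prod>t\<in>{..<N} - {k} - {x}. rat t x))"]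
    show ?thesis unfolding w by (simp add: mult_ac)
  qed
  then have "W g ({..<N} - {k}) k = (\<Sum>x\<in>{..<N} - {k}. weight x / complex_of_real (z k - z x + 1) * g x) + g k * weight k"
    unfolding W_def weight_def[symmetric] by simp
  then show ?thesis
    using k by (simp add: sum.remove[of "{..<N}" k])
qed

lemma Wfun_first: "w \<in> S \<Longrightarrow> w 0 = a \<Longrightarrow> Wfun a g (\<tau>, w) = g (\<tau> 0)"
  by (simp add: Wfun_def pinv_eq W_def)

text \<open>The value at a \<open>w\<close> with \<open>a\<close> first comes from a rotated
  \<open>w\<close> with \<open>a\<close> last, which \<open>W_full\<close> evaluates;
  \<open>Wfun_first\<close> recognizes the result.\<close>

lemma Y_Wfun:
  assumes a: "a < N"
  shows "Y b a (cut (Wfun a g)) =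
    cut (Wfun a (\<lambda>k. b k * (\<Sum>x<N. weight x / complex_of_real (z k - z x + 1) * g x)))"
proof -
  have N: "0 < N" using a by simp
  define w where "w = transpose 0 a"
  have w: "w \<in> S" "w 0 = a" using transpose_S[OF N a] by (simp_all add: w_def)
  show ?thesis
  proof (rule V_eqI[OF Y_V[OF a] cut_V[OF Wfun_F[OF a]] w(1)])
    fix \<tau> assume t: "\<tau> \<in> S"
    let ?c = "cyc N 1"
    have cS: "\<tau> \<circ> ?c \<in> S" "w \<circ> ?c \<in> S" using t w by (simp_all del: One_nat_def)
    have c: "?c (N - 1) = 0" using N by (simp add: cyc_1 del: One_nat_def)
    have "pinv (w \<circ> ?c) a = N - 1" by (rule pinv_eq[OF cS(2)]) (use w(2) c in simp)
    moreover have "(\<tau> \<circ> ?c) ` {..<N - 1} = {..<N} - {\<tau> 0}"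
    proof -
      have "{..<N} = insert (N - 1) {..<N - 1}" using N by auto
      then have "(\<tau> \<circ> ?c) ` {..<N} = insert (\<tau> 0) ((\<tau> \<circ> ?c) ` {..<N - 1})" using c by simp
      moreover have "(\<tau> \<circ> ?c) ` {..<N} = {..<N}" by (rule permutes_image[OF cS(1)[unfolded S_iff]])
      moreover have "\<tau> 0 \<notin> (\<tau> \<circ> ?c) ` {..<N - 1}"
      proof
        assume "\<tau> 0 \<in> (\<tau> \<circ> ?c) ` {..<N - 1}"
        then obtain j where j: "j < N - 1" "(\<tau> \<circ> ?c) (N - 1) = (\<tau> \<circ> ?c) j" using c by auto
        then show False using S_inj[OF cS(1)] by auto
      qed
      ultimately show ?thesis by (metis Diff_insert_absorb)
    qed
    ultimately have "cut (Wfun a g) (\<tau> \<circ> ?c, w \<circ> ?c) = W g ({..<N} - {\<tau> 0}) (\<tau> 0)"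
      unfolding cut_apply[OF cS] Wfun_def prod.case using c by simp
    then show "Y b a (cut (Wfun a g)) (\<tau>, w) =
        cut (Wfun a (\<lambda>k. b k * (\<Sum>x<N. weight x / complex_of_real (z k - z x + 1) * g x))) (\<tau>, w)"
      unfolding Y_apply[OF V_F[OF cut_V[OF Wfun_F[OF a]]] a t w] cut_apply[OF t w(1)] Wfun_first[OF w]
      by (simp only: W_full[OF S_less[OF t N]])
  qed
qed

end

section \<open>Reality of the coefficients\<close>

context exchange
begin

text \<open>Multiplication by \<open>b\<close> followed by \<open>Wfun a\<close> intertwines
  \<open>A\<close> with \<open>Y b a\<close>. The constant 1 lies in the image for every label
  \<open>a\<close>, so one common vector is killed by the polynomial in each
  \<open>Y b a\<close>.\<close>

lemma joint_Y_eigenvector: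
  assumes N: "0 < N"
    and A: "\<And>h k. k < N \<Longrightarrow> A h k = (\<Sum>j<N. \<beta> j / complex_of_real (z k - z j + 1) * h j)"
    and kill: "\<And>h k. k < N \<Longrightarrow> shift_prod A qs h k = 0"
    and \<beta>: "\<And>k. k < N \<Longrightarrow> \<beta> k \<noteq> 0"
  defines "b \<equiv> \<lambda>k. \<beta> k / weight k"
  obtains G l where "G \<in> F" "\<exists>\<tau>\<in>S. \<exists>w\<in>S. G (\<tau>, w) \<noteq> 0" "\<And>a. a < N \<Longrightarrow> l a \<in> set qs"
    "\<And>\<tau> w. \<tau> \<in> S \<Longrightarrow> w \<in> S \<Longrightarrow> b (\<tau> 0) * G (\<tau> \<circ> cyc N 1, w \<circ> cyc N 1) = l (w 0) * G (\<tau>, w)"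
proof -
  define emb where "emb a h = cut (Wfun a (\<lambda>k. b k * h k))" for a h
  have emb_cong: "emb a f = emb a g" if "a < N" "\<And>k. k < N \<Longrightarrow> f k = g k" for a f g
  proof (rule ext, clarify)
    fix \<tau> w
    show "emb a f (\<tau>, w) = emb a g (\<tau>, w)"
    proof (cases "\<tau> \<in> S \<and> w \<in> S")
      case True
      then have p: "pinv w a < N" using pinv_less that(1) by blast
      have "\<tau> ` {..<pinv w a} \<subseteq> {..<N}" "\<tau> (pinv w a) < N"
        using True p S_less[of \<tau>] by auto
      then show ?thesis
        using True that(2) unfolding emb_def cut_def Wfun_def by (auto intro: W_cong)
    qed (auto simp: emb_def cut_def)
  qed
  have emb_diff: "emb a (\<lambda>k. f k - c * g k) = (\<lambda>x. emb a f x - c * emb a g x)" for a f g c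
    using W_diff[of "\<lambda>k. b k * f k" c "\<lambda>k. b k * g k"]
    by (auto simp: emb_def cut_def Wfun_def fun_eq_iff right_diff_distrib mult.left_commute)
  have emb_V: "emb a h \<in> V" if "a < N" for a h
    unfolding emb_def by (rule cut_V[OF Wfun_F[OF that]])
  have Y_emb: "Y b a (emb a h) = emb a (A h)" if "a < N" for a h
  proof -
    have "(\<Sum>x<N. weight x / complex_of_real (z k - z x + 1) * (b x * h x)) = A h k" if "k < N" for k
      unfolding A[OF that] b_def by (intro sum.cong refl) (use weight_nz in simp)
    then have "W (\<lambda>k. b k * (\<Sum>x<N. weight x / complex_of_real (z k - z x + 1) * (b x * h x))) B y =
        W (\<lambda>k. b k * A h k) B y" if "B \<subseteq> {..<N}" "y < N" for B y
      using that by (intro W_cong) auto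
    moreover have "\<tau> ` {..<pinv w a} \<subseteq> {..<N}" "\<tau> (pinv w a) < N" if "\<tau> \<in> S" "w \<in> S" for \<tau> w
      using that pinv_less[OF that(2) \<open>a < N\<close>] S_less[of \<tau>] by auto
    ultimately show ?thesis
      unfolding emb_def Y_Wfun[OF that] by (auto simp: cut_def Wfun_def fun_eq_iff)
  qed
  have sp: "shift_prod (Y b a) ps (emb a h) = emb a (shift_prod A ps h)" if "a < N" for a ps h
    by (induction ps) (simp_all add: shift_prod_Cons emb_diff Y_emb[OF that])
  define one where "one = cut (\<lambda>_. 1)"
  have one_V: "one \<in> V" unfolding one_def by (rule cut_V[OF F_const])
  have b_nz: "b k \<noteq> 0" if "k < N" for k
    using \<beta>[OF that] weight_nz[OF that] by (simp add: b_def)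
  have one: "one = emb a (\<lambda>k. 1 / b k)" if a: "a < N" for a
  proof (rule V_eqI[OF one_V emb_V[OF a] transpose_S[OF N a]])
    fix \<tau> assume t: "\<tau> \<in> S"
    have "Wfun a (\<lambda>k. b k * (1 / b k)) (\<tau>, transpose 0 a) = 1"
      using Wfun_first[OF transpose_S[OF N a], of a "\<lambda>k. b k * (1 / b k)"] b_nz S_less[OF t N]
      by simp
    then show "one (\<tau>, transpose 0 a) = emb a (\<lambda>k. 1 / b k) (\<tau>, transpose 0 a)"
      using t transpose_S[OF N a] by (simp add: one_def emb_def cut_apply)
  qed
  have kill_one: "shift_prod (Y b a) qs one = (\<lambda>_. 0)" if a: "a < N" for a
  proof -
    \<comment> \<open>\<open>0 - 1 * 0\<close> brings the zero function into the shape of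
      \<open>emb_diff\<close>.\<close>
    have "shift_prod (Y b a) qs one = emb a (\<lambda>k. 0 - 1 * 0)"
      unfolding one[OF a] sp[OF a] by (rule emb_cong[OF a]) (simp add: kill)
    also have "\<dots> = (\<lambda>_. 0)"
      unfolding emb_diff by simp
    finally show ?thesis .
  qed
  have "one (id, id) \<noteq> 0" by (simp only: one_def cut_apply[OF id_S id_S] one_neq_zero not_False_eq_True)
  then have one_nz: "one \<noteq> (\<lambda>_. 0)" by (auto simp: fun_eq_iff)
  have "\<exists>v\<in>V. v \<noteq> (\<lambda>_. 0) \<and> (\<exists>l. \<forall>i\<in>{..<N}. l i \<in> set qs \<and> Y b i v = (\<lambda>x. l i * v x))"
  proof (rule joint_eigenvector[where ?v0.0 = one])
    show "Y b i (Y b j G) = Y b j (Y b i G)" if "i \<in> {..<N}" "j \<in> {..<N}" "G \<in> V" for i j G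
      using Y_commute[OF V_F] that by simp
  qed (use V_diff Y_V Y_lin one_V one_nz kill_one in auto)
  then obtain G l where G: "G \<in> V" "G \<noteq> (\<lambda>_. 0)"
    and l: "\<And>a. a < N \<Longrightarrow> l a \<in> set qs" "\<And>a. a < N \<Longrightarrow> Y b a G = (\<lambda>x. l a * G x)"
    by auto
  show thesis
  proof (rule that)
    show "G \<in> F" using G(1) by (rule V_F)
    obtain \<tau> w where "G (\<tau>, w) \<noteq> 0" using G(2) by (auto simp: fun_eq_iff)
    then show "\<exists>\<tau>\<in>S. \<exists>w\<in>S. G (\<tau>, w) \<noteq> 0" using G(1) unfolding V_def by blast
    show "l a \<in> set qs" if "a < N" for a using l(1)[OF that] .
    show "b (\<tau> 0) * G (\<tau> \<circ> cyc N 1, w \<circ> cyc N 1) = l (w 0) * G (\<tau>, w)" if t: "\<tau> \<in> S" "w \<in> S" for \<tau> w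
      using Y_apply[OF V_F[OF G(1)] S_less[OF t(2) N] t refl, of b] l(2)[OF S_less[OF t(2) N]] by simp
  qed
qed

lemma cyc_iterate:
  assumes R: "\<And>\<tau> w. \<tau> \<in> S \<Longrightarrow> w \<in> S \<Longrightarrow> b (\<tau> 0) * G (\<tau> \<circ> cyc N 1, w \<circ> cyc N 1) = l (w 0) * G (\<tau>, w)"
    and t: "\<tau> \<in> S" "w \<in> S"
  shows "k \<le> N \<Longrightarrow> (\<Prod>i<k. b (\<tau> i)) * G (\<tau> \<circ> cyc N k, w \<circ> cyc N k) = (\<Prod>i<k. l (w i)) * G (\<tau>, w)"
proof (induction k)
  case 0
  then show ?case by (simp only: cyc_0 comp_id lessThan_0 prod.empty)
next
  case (Suc k)
  \<comment> \<open>The next rotation starts at \<open>\<tau> \<circ> cyc N k\<close>, whose first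
    entry is \<open>\<tau> k\<close>.\<close>
  have 0: "cyc N k 0 = k" using Suc.prems by (simp add: cyc_def)
  have c: "v \<circ> cyc N (Suc k) = v \<circ> cyc N k \<circ> cyc N 1" for v
    by (simp only: cyc_Suc o_assoc)
  have "b (\<tau> k) * G (\<tau> \<circ> cyc N (Suc k), w \<circ> cyc N (Suc k)) = l (w k) * G (\<tau> \<circ> cyc N k, w \<circ> cyc N k)"
    using R[OF S_comp[OF t(1) cyc_S] S_comp[OF t(2) cyc_S], of k k] unfolding c o_apply 0 .
  then have "(\<Prod>i<Suc k. b (\<tau> i)) * G (\<tau> \<circ> cyc N (Suc k), w \<circ> cyc N (Suc k)) =
      (\<Prod>i<k. b (\<tau> i)) * (l (w k) * G (\<tau> \<circ> cyc N k, w \<circ> cyc N k))"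
    by (simp only: prod.lessThan_Suc mult.assoc)
  also have "\<dots> = l (w k) * ((\<Prod>i<k. b (\<tau> i)) * G (\<tau> \<circ> cyc N k, w \<circ> cyc N k))"
    by (simp only: mult.left_commute)
  also have "\<dots> = (\<Prod>i<Suc k. l (w i)) * G (\<tau>, w)"
    using Suc by (simp only: Suc_leD prod.lessThan_Suc mult_ac)
  finally show ?case .
qed

text \<open>Covers both parts of the theorem: \<open>m = 0\<close> with arbitrary signs, or
  \<open>m\<close> the size of the subset with a common sign.\<close>

lemma real_weights:
  assumes N: "0 < N"
    and A: "\<And>h k. k < N \<Longrightarrow> A h k = (\<Sum>j<N. \<beta> j / complex_of_real (z k - z j + 1) * h j)"
    and kill: "\<And>h k. k < N \<Longrightarrow> shift_prod A qs h k = 0"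
    and \<beta>: "\<And>k. k < N \<Longrightarrow> \<beta> k \<noteq> 0"
    and qs: "\<And>q. q \<in> set qs \<Longrightarrow> q \<in> \<real> \<and> q \<noteq> 0"
    and m: "m \<le> N" and t0: "\<tau>\<^sub>0 \<in> S" and sep: "separated m \<tau>\<^sub>0"
    and sign: "m = 0 \<or> (\<forall>q\<in>set qs. Re q > 0) \<or> (\<forall>q\<in>set qs. Re q < 0)"
    and k: "k < N"
  shows "\<beta> k \<in> \<real>"
proof -
  define b where "b = (\<lambda>k. \<beta> k / weight k)"
  obtain G l where G: "G \<in> F" and G_nz: "\<exists>\<tau>\<in>S. \<exists>w\<in>S. G (\<tau>, w) \<noteq> 0"
    and l: "\<And>a. a < N \<Longrightarrow> l a \<in> set qs"
    and R: "\<And>\<tau> w. \<tau> \<in> S \<Longrightarrow> w \<in> S \<Longrightarrow> b (\<tau> 0) * G (\<tau> \<circ> cyc N 1, w \<circ> cyc N 1) = l (w 0) * G (\<tau>, w)"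
    using joint_Y_eigenvector[OF N A kill \<beta>] unfolding b_def by blast
  define H where "H = (\<lambda>x. cnj (G x))"
  have H: "H \<in> F" unfolding H_def by (rule F_cnj[OF G])
  have l_cnj: "cnj (l a) = l a" if "a < N" for a
    using qs[OF l[OF that]] by (simp add: Reals_cnj_iff)
  have RH: "cnj (b (\<tau> 0)) * H (\<tau> \<circ> cyc N 1, w \<circ> cyc N 1) = l (w 0) * H (\<tau>, w)" if "\<tau> \<in> S" "w \<in> S" for \<tau> w
    using arg_cong[OF R[OF that], of cnj] l_cnj[OF S_less[OF that(2) N]] by (simp add: H_def)
  let ?B = "pairing 0 G H" and ?r = "block_rev N m" and ?rev = "block_rev N 0" and ?c = "cyc N 1"
  have B_eq: "?B \<tau> = (\<Sum>w\<in>S. G (\<tau>, w) * H (\<tau> \<circ> ?rev, w \<circ> ?rev))" for \<tau>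
    by (simp only: pairing_def block_perms_0_eq)
  have rS: "?r \<in> S" "?rev \<in> S"
    using block_rev_block_perms[OF m] block_rev_block_perms[of 0 N] by (auto intro: block_perms_S)
  have B_const: "?B \<tau> = ?B \<tau>\<^sub>0" if t: "\<tau> \<in> S" for \<tau>
  proof -
    have p: "\<tau>\<^sub>0 permutes {..<N}" using t0 by (simp add: S_iff)
    have "pinv \<tau>\<^sub>0 \<circ> \<tau> \<in> block_perms N 0"
      using p t by (simp add: block_perms_0_eq S_iff permutes_inv permutes_compose)
    from pairing_block[OF G H le0 t0 this] show ?thesis
      using permutes_inv_o(1)[OF p] by (simp only: o_assoc id_comp)
  qed
  have B_nz: "?B \<tau>\<^sub>0 \<noteq> 0"
  proof
    assume 0: "?B \<tau>\<^sub>0 = 0"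
    define q where "q w = (\<Prod>i<m. Re (l (w i)))" for w
    \<comment> \<open>The sign that makes every product of \<open>m\<close> eigenvalues positive;
      for \<open>m = 0\<close> the product is empty and equals 1.\<close>
    define e :: real where "e = (if m \<noteq> 0 \<and> (\<forall>q\<in>set qs. Re q < 0) then (- 1) ^ m else 1)"
    have less: "w i < N" if "w \<in> S" "i < m" for w i
      using S_less that m by auto
    have q_eq: "complex_of_real (q w) = (\<Prod>i<m. l (w i))" if w: "w \<in> S" for w
      unfolding q_def of_real_prod
      by (intro prod.cong refl) (use qs l less[OF w] in \<open>auto simp: of_real_Re\<close>)
    have q_inv: "q (w \<circ> v) = q w" if "v \<in> block_perms N m" for w v
    proof -
      have "bij_betw v {..<m} {..<m}"
        using that endo_inj_surj[of "{..<m}" v] permutes_inj_on[OF block_perms_permutes[OF that]]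
        by (auto simp: bij_betw_def block_perms_def)
      from prod.reindex_bij_betw[OF this, of "\<lambda>i. Re (l (w i))"] show ?thesis
        by (simp add: q_def)
    qed
    have q_pos: "e * q w > 0" if w: "w \<in> S" for w
    proof (cases "m \<noteq> 0 \<and> (\<forall>q\<in>set qs. Re q < 0)")
      case True
      then have "e * q w = (\<Prod>i<m. - Re (l (w i)))"
        by (simp add: e_def q_def prod_uminus)
      also have "\<dots> > 0"
        by (rule prod_pos) (use True l less[OF w] in auto)
      finally show ?thesis .
    next
      case False
      then have "e = 1" and "m = 0 \<or> (\<forall>q\<in>set qs. Re q > 0)" using sign by (auto simp: e_def)
      moreover from this have "q w > 0"
        unfolding q_def by (intro prod_pos) (use l less[OF w] in auto)
      ultimately show ?thesis by simp
    qed
    \<comment> \<open>Rotating by \<open>m\<close> replaces \<open>?r\<close> by \<open>?rev\<close>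
      in \<open>H\<close>. The eigenvalues collected form \<open>q w\<close>, while the factors from
      \<open>b\<close> do not depend on \<open>w\<close> and leave the sum.\<close>
    have term_w: "complex_of_real (e * q w) * (G (\<tau>\<^sub>0, w) * cnj (G (\<tau>\<^sub>0 \<circ> ?r, w \<circ> ?r))) =
        complex_of_real e * (\<Prod>i<m. cnj (b ((\<tau>\<^sub>0 \<circ> ?r) i))) * (G (\<tau>\<^sub>0, w) * H (\<tau>\<^sub>0 \<circ> ?rev, w \<circ> ?rev))"
      if w: "w \<in> S" for w
    proof -
      have rc: "v \<circ> ?r \<circ> cyc N m = v \<circ> ?rev" for v
        using arg_cong[OF block_rev_cyc[OF m], of "\<lambda>f. v \<circ> f"] by (simp only: o_assoc)
      have "(\<Prod>i<m. cnj (b ((\<tau>\<^sub>0 \<circ> ?r) i))) * H (\<tau>\<^sub>0 \<circ> ?rev, w \<circ> ?rev) = (\<Prod>i<m. l ((w \<circ> ?r) i)) * H (\<tau>\<^sub>0 \<circ> ?r, w \<circ> ?r)"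
        using cyc_iterate[of "\<lambda>k. cnj (b k)" H l "\<tau>\<^sub>0 \<circ> ?r" "w \<circ> ?r" m,
            OF RH S_comp[OF t0 rS(1)] S_comp[OF w rS(1)] m]
        unfolding rc by blast
      also have "(\<Prod>i<m. l ((w \<circ> ?r) i)) = complex_of_real (q w)"
        by (simp only: q_eq[OF S_comp[OF w rS(1)], symmetric] q_inv[OF block_rev_block_perms[OF m]])
      finally show ?thesis
        unfolding of_real_mult H_def by (simp add: mult_ac)
    qed
    have "(\<Sum>w\<in>S. complex_of_real (e * q w) * (G (\<tau>\<^sub>0, w) * cnj (G (\<tau>\<^sub>0 \<circ> ?r, w \<circ> ?r)))) =
        complex_of_real e * (\<Prod>i<m. cnj (b ((\<tau>\<^sub>0 \<circ> ?r) i))) * ?B \<tau>\<^sub>0"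
      unfolding B_eq sum_distrib_left by (intro sum.cong refl term_w)
    moreover have "(\<Sum>w\<in>S. complex_of_real (e * q w) * (G (\<tau>\<^sub>0, w) * cnj (G (\<tau>\<^sub>0 \<circ> ?r, w \<circ> ?r)))) \<noteq> 0"
      by (rule weighted_pairing_nonzero[OF G G_nz t0 sep m q_pos]) (simp_all only: q_inv)
    ultimately show False using 0 by simp
  qed
  \<comment> \<open>Rotating \<open>G\<close> yields the eigenvalue \<open>l (w 0)\<close> and
    rotating \<open>H\<close> back absorbs it, so only \<open>b (\<tau> 0)\<close> and its conjugate
    remain.\<close>
  have cyc_B: "b (\<tau> 0) * ?B (\<tau> \<circ> ?c) = cnj (b (\<tau> 0)) * ?B \<tau>" if t: "\<tau> \<in> S" for \<tau>
  proof -
    have exchange_factors: "x * (g' * h') = y * (g * h)" if "x * g' = c * g" "y * h = c * h'"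
      for x y c g g' h h' :: complex
    proof -
      have "x * (g' * h') = g * (c * h')" using that(1) by (simp add: mult.assoc[symmetric])
      then show ?thesis by (simp add: that(2)[symmetric] mult.left_commute)
    qed
    have cp: "?c permutes {..<N}" by (rule cyc_permutes)
    have "w \<circ> ?c \<circ> pinv ?c = w" "w \<circ> pinv ?c \<circ> ?c = w" for w :: "nat \<Rightarrow> nat"
      using permutes_inv_o[OF cp] by (simp_all only: o_assoc[symmetric] comp_id)
    moreover have "pinv ?c \<in> S" using cp by (simp add: S_iff permutes_inv)
    ultimately have shift: "?B (\<tau> \<circ> ?c) = (\<Sum>w\<in>S. G (\<tau> \<circ> ?c, w \<circ> ?c) * H (\<tau> \<circ> ?c \<circ> ?rev, w \<circ> ?c \<circ> ?rev))"
      unfolding B_eq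
      by (intro sum.reindex_bij_witness[of _ "\<lambda>w. w \<circ> ?c" "\<lambda>w. w \<circ> pinv ?c"])
        (auto simp del: One_nat_def)
    have "b (\<tau> 0) * ?B (\<tau> \<circ> ?c) = (\<Sum>w\<in>S. cnj (b (\<tau> 0)) * (G (\<tau>, w) * H (\<tau> \<circ> ?rev, w \<circ> ?rev)))"
      unfolding shift sum_distrib_left
    proof (intro sum.cong refl)
      fix w assume w: "w \<in> S"
      \<comment> \<open>Reversal puts the last place first and the rotation sends it to 0, so both
        relations carry the factors of \<open>\<tau> 0\<close> and \<open>w 0\<close>.\<close>
      have 0: "?c (?rev 0) = 0" using N by (simp add: block_rev_def cyc_1 del: One_nat_def)
      have crc: "v \<circ> ?c \<circ> ?rev \<circ> ?c = v \<circ> ?rev" for v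
        using arg_cong[OF cyc_block_rev_cyc[of N], of "\<lambda>f. v \<circ> f"] by (simp only: o_assoc)
      have S: "v \<circ> ?c \<circ> ?rev \<in> S" if "v \<in> S" for v
        using S_comp[OF S_comp[OF that cyc_S] rS(2)] .
      have "cnj (b (\<tau> 0)) * H (\<tau> \<circ> ?rev, w \<circ> ?rev) = l (w 0) * H (\<tau> \<circ> ?c \<circ> ?rev, w \<circ> ?c \<circ> ?rev)"
        using RH[OF S[OF t] S[OF w]] unfolding crc o_apply 0 .
      from exchange_factors[OF R[OF t w] this]
      show "b (\<tau> 0) * (G (\<tau> \<circ> ?c, w \<circ> ?c) * H (\<tau> \<circ> ?c \<circ> ?rev, w \<circ> ?c \<circ> ?rev)) =
          cnj (b (\<tau> 0)) * (G (\<tau>, w) * H (\<tau> \<circ> ?rev, w \<circ> ?rev))" .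
    qed
    also have "\<dots> = cnj (b (\<tau> 0)) * ?B \<tau>"
      unfolding B_eq[of \<tau>] by (rule sum_distrib_left[symmetric])
    finally show ?thesis .
  qed
  define \<tau> where "\<tau> = transpose 0 k"
  have t: "\<tau> \<in> S" "\<tau> 0 = k" using transpose_S[OF N k] by (simp_all add: \<tau>_def)
  have "b k = cnj (b k)"
    using cyc_B[OF t(1)] B_const[OF t(1)] B_const[OF S_comp[OF t(1) cyc_S]] B_nz t(2) by simp
  then have "b k \<in> \<real>" by (simp add: Reals_cnj_iff)
  then have "b k * weight k \<in> \<real>" using weight_Reals by (rule Reals_mult)
  then show ?thesis using weight_nz[OF k] by (simp add: b_def)
qed

end

section \<open>Distinct points, nonzero coefficients and the theorem\<close>

lemma Qd_index:
  "i < N \<Longrightarrow> j < N \<Longrightarrow> Qd N z b $$ (i, j) = b j / complex_of_real (z i - z j + 1)"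
  by (simp add: Qd_def)

text \<open>Each factor multiplies the difference of the two values by \<open>- q\<close>, so
  nonzero shifts cannot kill a function that separates \<open>i\<close> and
  \<open>j\<close>.\<close>

lemma shift_prod_equal_rows:
  assumes "\<And>g. A g i = A g j"
  shows "shift_prod A qs h i - shift_prod A qs h j = (\<Prod>q\<leftarrow>qs. - q) * (h i - h j)"
proof (induction qs)
  case (Cons q qs)
  have "shift_prod A (q # qs) h i - shift_prod A (q # qs) h j =
      - q * (shift_prod A qs h i - shift_prod A qs h j)"
    by (simp add: shift_prod_Cons assms algebra_simps)
  then show ?case by (simp add: Cons.IH)
qed simp

text \<open>\<open>A\<close> sends the indicator of a zero column to 0, so each factor only
  multiplies it by \<open>- q\<close>.\<close>

lemma shift_prod_zero_column:
  assumes "\<And>g i. i < N \<Longrightarrow> A g i = (\<Sum>j<N. a i j * g j)" "\<And>i. i < N \<Longrightarrow> a i k = (0 :: complex)"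
  shows "i < N \<Longrightarrow> shift_prod A qs (\<lambda>j. of_bool (j = k)) i = (\<Prod>q\<leftarrow>qs. - q) * of_bool (i = k)"
proof (induction qs arbitrary: i)
  case (Cons q qs)
  have "A (shift_prod A qs (\<lambda>j. of_bool (j = k))) i = 0"
    unfolding assms(1)[OF Cons.prems] by (intro sum.neutral ballI) (use assms(2) Cons in auto)
  then show ?case using Cons by (simp add: shift_prod_Cons)
qed simp

text \<open>Listing the subset first turns the two classes of the second part into the two
  blocks.\<close>

lemma permutation_onto_prefix:
  assumes "I \<subseteq> {..<N}"
  obtains \<tau> where "\<tau> permutes {..<N}" "\<And>i. i < N \<Longrightarrow> \<tau> i \<in> I \<longleftrightarrow> i < card I"
proof -
  let ?m = "card I"
  have fin: "finite I" using assms finite_subset by blast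
  have m: "?m \<le> N" using card_mono[OF _ assms] by simp
  obtain f where f: "bij_betw f {..<?m} I"
    using ex_bij_betw_nat_finite[OF fin] by (auto simp: atLeast0LessThan)
  have "card ({?m..<N}) = card ({..<N} - I)"
    using card_Diff_subset[OF fin assms] by simp
  then obtain g where g: "bij_betw g {?m..<N} ({..<N} - I)"
    using finite_same_card_bij[of "{?m..<N}" "{..<N} - I"] by auto
  define \<tau> where "\<tau> i = (if i < ?m then f i else if i < N then g i else i)" for i
  have "bij_betw \<tau> {..<?m} I" by (rule bij_betw_cong[THEN iffD1, OF _ f]) (simp add: \<tau>_def)
  moreover have "bij_betw \<tau> {?m..<N} ({..<N} - I)"
    by (rule bij_betw_cong[THEN iffD1, OF _ g]) (simp add: \<tau>_def)
  ultimately have "bij_betw \<tau> ({..<?m} \<union> {?m..<N}) (I \<union> ({..<N} - I))"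
    by (rule bij_betw_combine) auto
  moreover have "{..<?m} \<union> {?m..<N} = {..<N}" "I \<union> ({..<N} - I) = {..<N}"
    using m assms by auto
  ultimately have "\<tau> permutes {..<N}"
    using m by (intro bij_imp_permutes) (auto simp: \<tau>_def)
  moreover have "\<tau> i \<in> I \<longleftrightarrow> i < ?m" if "i < N" for i
    using that bij_betwE[OF f] bij_betwE[OF g] by (auto simp: \<tau>_def)
  ultimately show thesis by (rule that)
qed

theorem theorem6p6:
  fixes N :: nat and z :: "nat \<Rightarrow> real" and b Q :: "nat \<Rightarrow> complex"
  assumes "N \<ge> 2"
    and "\<forall>i<N. \<forall>j<N. z i - z j \<noteq> 1"
    and "spectrum (Qd N z b) = Q ` {..<N}"
    and "inj_on Q {..<N}"
    and "\<forall>i<N. Q i \<in> \<real> \<and> Q i \<noteq> 0"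
  shows "((\<forall>i<N. \<forall>j<N. i \<noteq> j \<longrightarrow> \<bar>z i - z j\<bar> > 1) \<longrightarrow> (\<forall>i<N. b i \<in> \<real>)) \<and>
    (((\<forall>i<N. Re (Q i) > 0) \<or> (\<forall>i<N. Re (Q i) < 0)) \<and>
     (\<exists>I\<subseteq>{..<N}. \<forall>i<N. \<forall>j<N.
        i \<noteq> j \<and> (i \<in> I \<and> j \<in> I \<or> i \<notin> I \<and> j \<notin> I) \<longrightarrow> \<bar>z i - z j\<bar> \<ge> 1)
     \<longrightarrow> (\<forall>i<N. b i \<in> \<real>))"
proof -
  define A where "A = (\<lambda>g k. \<Sum>j<N. Qd N z b $$ (k, j) * g j)"
  define qs where "qs = map Q [0..<N]"
  have A: "A g k = (\<Sum>j<N. b j / complex_of_real (z k - z j + 1) * g j)" if "k < N" for g k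
    unfolding A_def using that by (intro sum.cong refl) (simp add: Qd_index)
  have kill: "shift_prod A qs g k = 0" if "k < N" for g k
    unfolding A_def qs_def by (rule shift_prod_spectrum[OF _ assms(3,4) that]) (simp add: Qd_def)
  have qs: "q \<in> \<real> \<and> q \<noteq> 0" if "q \<in> set qs" for q
    using that assms(5) by (auto simp: qs_def)
  then have prod_nz: "(\<Prod>q\<leftarrow>qs. - q) \<noteq> 0"
    by (auto simp: prod_list_zero_iff)
  \<comment> \<open>Equal points would give equal rows, incompatible with nonzero
    eigenvalues.\<close>
  have z_inj: "z i \<noteq> z j" if ij: "i < N" "j < N" "i \<noteq> j" for i j
  proof
    assume "z i = z j"
    then have "A g i = A g j" for g by (simp only: A[OF ij(1)] A[OF ij(2)])
    from shift_prod_equal_rows[of A i j qs "\<lambda>k. of_bool (k = i)", OF this]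
    show False using kill ij prod_nz by simp
  qed
  have b_nz: "b k \<noteq> 0" if k: "k < N" for k
  proof
    assume "b k = 0"
    then have "shift_prod A qs (\<lambda>j. of_bool (j = k)) k = (\<Prod>q\<leftarrow>qs. - q) * of_bool (k = k)"
      by (intro shift_prod_zero_column[OF A _ k]) auto
    then show False using kill[OF k] prod_nz by simp
  qed
  interpret exchange N z
    by unfold_locales (use z_inj assms(2) in auto)
  have N: "0 < N" using assms(1) by simp
  have reality: "b k \<in> \<real>" if "m \<le> N" "\<tau> \<in> S" "separated m \<tau>"
      "m = 0 \<or> (\<forall>q\<in>set qs. Re q > 0) \<or> (\<forall>q\<in>set qs. Re q < 0)" "k < N" for m \<tau> k
    by (rule real_weights[OF N A kill b_nz qs that])
  show ?thesis
  proof (intro conjI impI allI)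
    fix i assume "\<forall>i<N. \<forall>j<N. i \<noteq> j \<longrightarrow> \<bar>z i - z j\<bar> > 1" and i: "i < N"
    then have "separated 0 id" by (simp add: separated_def)
    then show "b i \<in> \<real>" using reality[OF le0 id_S _ _ i] by blast
  next
    fix i assume H: "((\<forall>i<N. Re (Q i) > 0) \<or> (\<forall>i<N. Re (Q i) < 0)) \<and>
     (\<exists>I\<subseteq>{..<N}. \<forall>i<N. \<forall>j<N.
        i \<noteq> j \<and> (i \<in> I \<and> j \<in> I \<or> i \<notin> I \<and> j \<notin> I) \<longrightarrow> \<bar>z i - z j\<bar> \<ge> 1)"
      and i: "i < N"
    obtain I where I: "I \<subseteq> {..<N}" and I_far: "\<forall>i<N. \<forall>j<N.
        i \<noteq> j \<and> (i \<in> I \<and> j \<in> I \<or> i \<notin> I \<and> j \<notin> I) \<longrightarrow> \<bar>z i - z j\<bar> \<ge> 1"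
      using conjunct2[OF H] by (elim exE conjE)
    have far: "\<bar>z i - z j\<bar> \<ge> 1" if "i < N" "j < N" "i \<noteq> j" "i \<in> I \<longleftrightarrow> j \<in> I" for i j
      using I_far[rule_format, OF that(1,2)] that(3,4) by simp
    obtain \<tau> where \<tau>: "\<tau> permutes {..<N}" "\<And>i. i < N \<Longrightarrow> \<tau> i \<in> I \<longleftrightarrow> i < card I"
      using permutation_onto_prefix[OF I] by metis
    have t: "\<tau> \<in> S" using \<tau>(1) by (simp add: S_iff)
    have "\<bar>z (\<tau> a) - z (\<tau> c)\<bar> > 1" if ac: "a < N" "c < N" "a \<noteq> c" "a < card I \<longleftrightarrow> c < card I" for a c
    proof -
      have lt: "\<tau> a < N" "\<tau> c < N" using S_less[OF t] ac by auto
      have "\<bar>z (\<tau> a) - z (\<tau> c)\<bar> \<ge> 1"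
        by (rule far[OF lt]) (use ac \<tau>(2) S_inj[OF t] in auto)
      \<comment> \<open>The excluded differences 1 and -1 make the bound strict.\<close>
      then show ?thesis using z_gap[OF lt] z_gap[OF lt(2,1)] by linarith
    qed
    then have "separated (card I) \<tau>" by (simp add: separated_def)
    moreover have "card I \<le> N" using card_mono[OF _ I] by simp
    moreover have "(\<forall>q\<in>set qs. Re q > 0) \<or> (\<forall>q\<in>set qs. Re q < 0)"
      using H by (auto simp: qs_def)
    ultimately show "b i \<in> \<real>" using reality[OF _ t _ _ i] by blast
  qed
qed

end
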